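(* Let $\{(N_n,B_n,L_n)\}_{n\ge 1}$ be a sequence of Hadamard triples with $B_n\subset\{0,1,\dots,N_n-1\}$ for all $n\ge 1$. Suppose that the sequence of measures $\{\nu_{>n}\}$ does not converge weakly to $\rho=\frac12(\delta_0+\delta_1)$. Then the associated Cantor-Moran measure $\mu(N_n,B_n)$ is a spectral measure, and it admits a spectrum $\Lambda\subset\mathbb{Z}$.
   Context: A Hadamard triple $(N,B,L)$ consists of an integer $N\ge 2$ and finite sets $B,L\subset\mathbb{Z}$ with $\#B=\#L=M\le N$ such that the matrix $H=\frac{1}{\sqrt M}\left[e^{-2\pi i bl/N}\right]_{b\in B,\,l\in L}$ is unitary. For a finite nonempty set $A\subset\mathbb{R}$, $\delta_A=\frac{1}{\#A}\sum_{a\in A}\delta_a$, where $\delta_a$ is the Dirac measure at $a$. The Cantor-Moran measure is $\mu(N_n,B_n)=\delta_{\frac{1}{N_1}B_1}\ast\delta_{\frac{1}{N_1N_2}B_2}\ast\delta_{\frac{1}{N_1N_2N_3}B_3}\ast\cdots$ (weak limit of the finite convolutions), a Borel probability measure supported in $[0,1]$. Write $\mu=\mu_n\ast\mu_{>n}$, where $\mu_n$ is the convolution of the first $n$ discrete measures and $\mu_{>n}$ is the convolution of the remaining ones, and let $\nu_{>n}(E)=\mu_{>n}\big((N_1\cdots N_n)^{-1}E\big)$ for Borel sets $E$; thus $\nu_{>n}=\delta_{\frac{1}{N_{n+1}}B_{n+1}}\ast\delta_{\frac{1}{N_{n+1}N_{n+2}}B_{n+2}}\ast\cdots$. A Borel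 probability measure $\mu$ on $\mathbb{R}$ is a spectral measure if there is a countable set $\Lambda\subset\mathbb{R}$ (called a spectrum) such that $\{e^{2\pi i\lambda x}:\lambda\in\Lambda\}$ is an orthonormal basis of $L^2(\mu)$. *)

theory Defs
  imports "HOL-Probability.Probability"
begin

definition hadamard_matrix :: "int \<Rightarrow> int set \<Rightarrow> int \<Rightarrow> int \<Rightarrow> complex" where
  "hadamard_matrix N B b l =
     complex_of_real (1 / sqrt (real (card B))) *
     exp (- 2 * complex_of_real pi * \<i> * of_int b * of_int l / of_int N)"

text \<open>Matrices are functions of a row index in \<open>R\<close> and a column index in \<open>C\<close>; unitary
  means \<open>H H\<^sup>* = I\<close> and \<open>H\<^sup>* H = I\<close>.\<close>

definition unitary_matrix_on :: "'r set \<Rightarrow> 'c set \<Rightarrow> ('r \<Rightarrow> 'c \<Rightarrow> complex) \<Rightarrow> bool" where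
  "unitary_matrix_on R C H \<longleftrightarrow>
     (\<forall>r\<in>R. \<forall>r'\<in>R. (\<Sum>c\<in>C. H r c * cnj (H r' c)) = (if r = r' then 1 else 0)) \<and>
     (\<forall>c\<in>C. \<forall>c'\<in>C. (\<Sum>r\<in>R. cnj (H r c) * H r c') = (if c = c' then 1 else 0))"

definition hadamard_triple :: "int \<Rightarrow> int set \<Rightarrow> int set \<Rightarrow> bool" where
  "hadamard_triple N B L \<longleftrightarrow>
     N \<ge> 2 \<and> finite B \<and> finite L \<and> B \<noteq> {} \<and> card B = card L \<and> int (card B) \<le> N \<and>
     unitary_matrix_on B L (hadamard_matrix N B)"

text \<open>The uniform distribution on a finite nonempty set, as a Borel measure on the line;
  see \<open>measure_unif_dirac\<close>.\<close>

definition unif_dirac :: "real set \<Rightarrow> real measure" where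
  "unif_dirac A = distr (measure_pmf (pmf_of_set A)) borel (\<lambda>x. x)"

lemma real_distribution_unif_dirac: "real_distribution (unif_dirac A)"
  unfolding unif_dirac_def
  by (intro prob_space.real_distribution_distr measure_pmf.prob_space_axioms) simp

lemma measure_unif_dirac:
  assumes "finite A" "A \<noteq> {}" "E \<in> sets borel"
  shows "measure (unif_dirac A) E = (\<Sum>a\<in>A. measure (return borel a) E) / real (card A)"
proof -
  have "measure (unif_dirac A) E = real (card (A \<inter> E)) / real (card A)"
    using assms unfolding unif_dirac_def
    by (simp add: measure_distr measure_pmf_of_set)
  also have "real (card (A \<inter> E)) = (\<Sum>a\<in>A. measure (return borel a) E)"
    using assms by (simp add: measure_return indicator_def if_distrib sum.If_cases Int_def)
  finally show ?thesis .
qed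

text \<open>\<open>fin_conv X n\<close> is the convolution of \<open>X 0, \<dots>, X (n - 1)\<close>; the Dirac measure at \<open>0\<close> is
  the neutral element.\<close>

primrec fin_conv :: "(nat \<Rightarrow> real measure) \<Rightarrow> nat \<Rightarrow> real measure" where
  "fin_conv X 0 = return borel 0"
| "fin_conv X (Suc n) = convolution (fin_conv X n) (X n)"

definition inf_conv :: "(nat \<Rightarrow> real measure) \<Rightarrow> real measure" where
  "inf_conv X = (THE \<mu>. real_distribution \<mu> \<and> weak_conv_m (fin_conv X) \<mu>)"

lemma real_distribution_fin_conv:
  assumes "\<And>n. real_distribution (X n)"
  shows "real_distribution (fin_conv X n)"
proof (induction n)
  case 0
  have "prob_space (return borel (0::real))"
    by (rule prob_space_return) simp
  then show ?case
    by (simp add: real_distribution_def real_distribution_axioms_def)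
next
  case (Suc n)
  interpret A: real_distribution "fin_conv X n" by fact
  interpret B: real_distribution "X n" by fact
  interpret P: pair_prob_space "fin_conv X n" "X n" ..
  show ?case
    unfolding fin_conv.simps convolution_def
    by (intro P.real_distribution_distr) (measurable)
qed

lemma inf_conv_eqI:
  assumes X: "\<And>n. real_distribution (X n)"
    and \<mu>: "real_distribution \<mu>" "weak_conv_m (fin_conv X) \<mu>"
  shows "inf_conv X = \<mu>"
  unfolding inf_conv_def
proof (rule the_equality)
  fix \<nu> assume \<nu>: "real_distribution \<nu> \<and> weak_conv_m (fin_conv X) \<nu>"
  then have \<nu>': "real_distribution \<nu>" "weak_conv_m (fin_conv X) \<nu>" by simp_all
  note lim = levy_continuity1[OF real_distribution_fin_conv[OF X]]
  have "char \<nu> = char \<mu>"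
    by (rule ext, rule LIMSEQ_unique[OF lim[OF \<nu>'] lim[OF \<mu>]])
  with \<nu>'(1) \<mu>(1) show "\<nu> = \<mu>"
    by (rule Levy_uniqueness)
qed (use \<mu> in simp)

text \<open>Sequences are indexed from \<open>1\<close>; the values \<open>N 0\<close> and \<open>B 0\<close> are never used.\<close>

definition scale :: "(nat \<Rightarrow> int) \<Rightarrow> nat \<Rightarrow> real" where
  "scale N n = (\<Prod>i=1..n. real_of_int (N i))"

definition moran_factor :: "(nat \<Rightarrow> int) \<Rightarrow> (nat \<Rightarrow> int set) \<Rightarrow> nat \<Rightarrow> real measure" where
  "moran_factor N B n = unif_dirac ((\<lambda>b. (1 / scale N n) * real_of_int b) ` B n)"

definition cantor_moran :: "(nat \<Rightarrow> int) \<Rightarrow> (nat \<Rightarrow> int set) \<Rightarrow> real measure" where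
  "cantor_moran N B = inf_conv (\<lambda>k. moran_factor N B (k + 1))"

definition mu_tail :: "(nat \<Rightarrow> int) \<Rightarrow> (nat \<Rightarrow> int set) \<Rightarrow> nat \<Rightarrow> real measure" where
  "mu_tail N B n = inf_conv (\<lambda>k. moran_factor N B (n + k + 1))"

text \<open>The measure \<open>E \<mapsto> \<mu>\<^sub>>\<^sub>n ((N\<^sub>1 \<cdots> N\<^sub>n)\<inverse> E)\<close> is the image of \<open>\<mu>\<^sub>>\<^sub>n\<close> under multiplication by
  \<open>N\<^sub>1 \<cdots> N\<^sub>n\<close>.\<close>

definition nu_tail :: "(nat \<Rightarrow> int) \<Rightarrow> (nat \<Rightarrow> int set) \<Rightarrow> nat \<Rightarrow> real measure" where
  "nu_tail N B n = distr (mu_tail N B n) borel (\<lambda>x. scale N n * x)"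

text \<open>The library has no \<open>L\<^sup>2\<close> Hilbert space, so its elements are represented by
  square-integrable functions (not quotiented by almost-everywhere equality).\<close>

definition L2_fun :: "'a measure \<Rightarrow> ('a \<Rightarrow> complex) set" where
  "L2_fun M = {f \<in> borel_measurable M. integrable M (\<lambda>x. (cmod (f x))\<^sup>2)}"

definition L2_inner :: "'a measure \<Rightarrow> ('a \<Rightarrow> complex) \<Rightarrow> ('a \<Rightarrow> complex) \<Rightarrow> complex" where
  "L2_inner M f g = (\<integral>x. f x * cnj (g x) \<partial>M)"

definition L2_dist :: "'a measure \<Rightarrow> ('a \<Rightarrow> complex) \<Rightarrow> ('a \<Rightarrow> complex) \<Rightarrow> real" where
  "L2_dist M f g = sqrt (\<integral>x. (cmod (f x - g x))\<^sup>2 \<partial>M)"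

text \<open>Orthonormal basis in the Hilbert space sense: an orthonormal family whose linear span is
  dense. The family is indexed, so distinct indices give orthogonal elements.\<close>

definition orthonormal_basis_L2 :: "'a measure \<Rightarrow> 'i set \<Rightarrow> ('i \<Rightarrow> 'a \<Rightarrow> complex) \<Rightarrow> bool" where
  "orthonormal_basis_L2 M I e \<longleftrightarrow>
     (\<forall>i\<in>I. e i \<in> L2_fun M) \<and>
     (\<forall>i\<in>I. \<forall>j\<in>I. L2_inner M (e i) (e j) = (if i = j then 1 else 0)) \<and>
     (\<forall>f\<in>L2_fun M. \<forall>\<epsilon>>0. \<exists>F c. finite F \<and> F \<subseteq> I \<and>
        L2_dist M f (\<lambda>x. \<Sum>i\<in>F. c i * e i x) < \<epsilon>)"

definition is_spectrum :: "real measure \<Rightarrow> real set \<Rightarrow> bool" where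
  "is_spectrum \<mu> \<Lambda> \<longleftrightarrow> countable \<Lambda> \<and>
     orthonormal_basis_L2 \<mu> \<Lambda>
       (\<lambda>\<xi> x. exp (2 * complex_of_real pi * \<i> * of_real \<xi> * of_real x))"

definition spectral_measure :: "real measure \<Rightarrow> bool" where
  "spectral_measure \<mu> \<longleftrightarrow> real_distribution \<mu> \<and> (\<exists>\<Lambda>. is_spectrum \<mu> \<Lambda>)"

end

theory Submission
  imports Defs
begin

text \<open>
  The Fourier transform of \<open>\<mu>\<close> factors as \<open>P\<^sub>n(\<xi>) * F\<^sub>n(\<xi> / (N\<^sub>1 \<cdots> N\<^sub>n))\<close>, where \<open>P\<^sub>n\<close> is the transform
  of \<open>\<mu>\<^sub>n\<close> and \<open>F\<^sub>n\<close> that of \<open>\<nu>\<^sub>>\<^sub>n\<close>. If \<open>\<nu>\<^sub>>\<^sub>n\<close> does not converge to \<open>\<rho>\<close>, some subsequence converges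
  to a measure \<open>\<nu> \<noteq> \<rho>\<close> on \<open>[0, 1]\<close>. The only such measure whose transform vanishes on a whole coset of
  \<open>\<int>\<close> is \<open>\<rho>\<close>, so by compactness there are \<open>\<epsilon>, \<delta> > 0\<close> and infinitely many \<open>n\<close> such that every real number
  has an integer translate around which \<open>\<bar>F\<^sub>n\<bar> \<ge> \<epsilon>\<close> on a \<open>\<delta>\<close>-neighbourhood.

  The Hadamard triples provide finite integer spectra of the \<open>\<mu>\<^sub>n\<close>, which can be extended from one level to
  a later one, and whose elements can be moved by multiples of \<open>N\<^sub>1 \<cdots> N\<^sub>n\<close> because \<open>P\<^sub>n\<close> has this period.
  Choosing good translates for the new elements at infinitely many levels gives an increasing sequence of
  spectra on which \<open>\<bar>P\<^sub>n\<bar>\<^sup>2 \<le> \<bar>\<mu>^\<bar>\<^sup>2 / \<epsilon>\<^sup>2\<close>. Hence no mass of \<open>\<Sum> \<bar>P\<^sub>n\<bar>\<^sup>2 = 1\<close> is lost in the limit, and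
  Parseval's identity holds in the union for all exponentials, which span a dense subspace.
\<close>

section \<open>Measures on an interval\<close>

text \<open>The exponent carries the positive sign, so that the inner product of the exponentials
  with frequencies \<open>a\<close> and \<open>b\<close> is \<open>ft M (a - b)\<close>.\<close>

definition ft :: "real measure \<Rightarrow> real \<Rightarrow> complex" where
  "ft M \<xi> = char M (2 * pi * \<xi>)"

lemma ft_eq_integral: "ft M \<xi> = (\<integral>x. cis (2 * pi * \<xi> * x) \<partial>M)"
  by (simp add: ft_def char_def cis_conv_exp)

lemma char_convolution:
  assumes "real_distribution M" "real_distribution K"
  shows "char (convolution M K) t = char M t * char K t"
proof -
  interpret M: real_distribution M by fact
  interpret K: real_distribution K by fact
  interpret P: pair_prob_space M K ..
  have int: "integrable (M \<Otimes>\<^sub>M K) (\<lambda>z. cis (t * (fst z + snd z)))"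
    by (intro P.integrable_const_bound[of _ 1]) (auto simp: cis_conv_exp)
  have "char (convolution M K) t = (\<integral>z. cis (t * (fst z + snd z)) \<partial>(M \<Otimes>\<^sub>M K))"
    unfolding char_def convolution_def
    by (subst integral_distr) (auto simp: cis_conv_exp case_prod_beta)
  also have "\<dots> = (\<integral>x. \<integral>y. cis (t * (x + y)) \<partial>K \<partial>M)"
    using P.integral_fst'[OF int] by simp
  also have "\<dots> = (\<integral>x. \<integral>y. cis (t * x) * cis (t * y) \<partial>K \<partial>M)"
    by (simp add: cis_mult distrib_left)
  also have "\<dots> = char M t * char K t"
    unfolding char_def by (simp add: cis_conv_exp)
  finally show ?thesis .
qed

lemma AE_convolution_atLeastAtMost:
  fixes a b :: real
  assumes "real_distribution M" "real_distribution K"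
    and M: "AE x in M. x \<in> {0..a}" and K: "AE x in K. x \<in> {0..b}"
  shows "AE x in convolution M K. x \<in> {0..a + b}"
proof -
  interpret M: real_distribution M by fact
  interpret K: real_distribution K by fact
  interpret P: pair_prob_space M K ..
  have "AE z in M \<Otimes>\<^sub>M K. (\<lambda>(x, y). x + y) z \<in> {0..a + b}"
  proof (rule P.AE_pair_measure)
    show "AE x in M. AE y in K. (\<lambda>(x, y). x + y) (x, y) \<in> {0..a + b}"
      using M by eventually_elim (use K in eventually_elim, auto)
  qed measurable
  then show ?thesis
    unfolding convolution_def by (subst AE_distr_iff) auto
qed

text \<open>The function \<open>f\<close> is bounded and continuous and vanishes exactly on
  \<open>{a..b}\<close>. Its integral is 0 along the sequence, hence also in the limit.\<close>

lemma AE_weak_limit_atLeastAtMost: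
  fixes a b :: real
  assumes "\<And>n. real_distribution (M n)" "real_distribution M'" "weak_conv_m M M'"
    and supp: "\<And>n. AE x in M n. x \<in> {a..b}"
  shows "AE x in M'. x \<in> {a..b}"
proof -
  interpret M': real_distribution M' by fact
  define f where "f x = min 1 (max 0 (max (a - x) (x - b)))" for x
  have cont: "isCont f x" for x
    unfolding f_def by (intro continuous_intros)
  then have [measurable]: "f \<in> borel_measurable borel"
    by (intro borel_measurable_continuous_onI continuous_at_imp_continuous_on) auto
  have "(\<lambda>n. integral\<^sup>L (M n) f) \<longlonglongrightarrow> integral\<^sup>L M' f"
    using assms(1-3) cont by (rule weak_conv_imp_integral_bdd_continuous_conv[where B = 1]) (auto simp: f_def)
  moreover have "integral\<^sup>L (M n) f = 0" for n
    by (intro integral_eq_zero_AE, use supp[of n] in eventually_elim) (auto simp: f_def)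
  ultimately have "integral\<^sup>L M' f = 0"
    by (simp add: LIMSEQ_const_iff)
  moreover have "integrable M' f"
    by (intro M'.integrable_const_bound[of _ 1]) (auto simp: f_def)
  ultimately have "AE x in M'. f x = 0"
    by (subst (asm) integral_nonneg_eq_0_iff_AE) (auto simp: f_def)
  then show ?thesis
    by eventually_elim (auto simp: f_def min_def max_def split: if_splits)
qed

lemma norm_char_diff_le:
  assumes "real_distribution M" and supp: "AE x in M. x \<in> {0..a}"
  shows "norm (char M s - char M t) \<le> \<bar>s - t\<bar> * a"
proof -
  interpret M: real_distribution M by fact
  have *: "norm (cis u - cis v) \<le> \<bar>u - v\<bar>" for u v :: real
  proof -
    have "cis u - cis v = cis v * (cis (u - v) - 1)"
      by (simp add: right_diff_distrib cis_mult)
    then show ?thesis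
      using iexp_approx1[of "u - v" 0] by (simp add: norm_mult cis_conv_exp)
  qed
  have int: "integrable M (\<lambda>x. cis (u * x))" for u
    by (intro M.integrable_const_bound[of _ 1]) (auto simp: cis_conv_exp)
  have "norm (char M s - char M t) = norm (\<integral>x. cis (s * x) - cis (t * x) \<partial>M)"
    using int by (simp add: char_def cis_conv_exp)
  also have "\<dots> \<le> (\<integral>x. norm (cis (s * x) - cis (t * x)) \<partial>M)"
    by (rule integral_norm_bound)
  also have "\<dots> \<le> (\<integral>x. \<bar>s - t\<bar> * a \<partial>M)"
  proof (rule integral_mono_AE)
    show "AE x in M. norm (cis (s * x) - cis (t * x)) \<le> \<bar>s - t\<bar> * a"
      using supp
    proof eventually_elim
      case (elim x)
      have "norm (cis (s * x) - cis (t * x)) \<le> \<bar>(s - t) * x\<bar>"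
        using *[of "s * x" "t * x"] by (simp add: left_diff_distrib)
      also have "\<dots> \<le> \<bar>s - t\<bar> * a"
        using elim by (auto simp: abs_mult intro!: mult_left_mono)
      finally show ?case .
    qed
  qed (use int in auto)
  finally show ?thesis by (simp add: M.prob_space del: M.space_eq_univ)
qed

text \<open>The Lipschitz constant is the same for all measures on [0, 1]. This turns lower bounds
  at single points into bounds on neighbourhoods, uniformly along a sequence of measures.\<close>

lemma norm_ft_diff_le:
  assumes "real_distribution M" "AE x in M. x \<in> {0..1}"
  shows "cmod (ft M \<xi> - ft M \<eta>) \<le> 2 * pi * \<bar>\<xi> - \<eta>\<bar>"
proof -
  have "2 * pi * \<xi> - 2 * pi * \<eta> = 2 * pi * (\<xi> - \<eta>)"
    by (simp add: algebra_simps)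
  then show ?thesis
    using norm_char_diff_le[OF assms, of "2 * pi * \<xi>" "2 * pi * \<eta>"] by (simp add: ft_def abs_mult)
qed

lemma tight_atLeastAtMost:
  fixes a b :: real
  assumes "\<And>n. real_distribution (M n)" and supp: "\<And>n. AE x in M n. x \<in> {a..b}"
  shows "tight M"
  unfolding tight_def
proof (intro conjI allI impI)
  fix e :: real assume "e > 0"
  have "measure (M n) {min a b - 1<..max a b} = 1" for n
  proof -
    interpret M: real_distribution "M n" by fact
    show ?thesis
      by (subst M.prob_eq_1, simp, use supp[of n] in eventually_elim, auto)
  qed
  then show "\<exists>a b. a < b \<and> (\<forall>n. 1 - e < measure (M n) {a<..b})"
    using \<open>e > 0\<close> by (intro exI[of _ "min a b - 1"] exI[of _ "max a b"]) auto
qed fact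

section \<open>Infinite convolutions on a bounded interval\<close>

lemma char_fin_conv:
  assumes "\<And>n. real_distribution (X n)"
  shows "char (fin_conv X n) t = (\<Prod>i<n. char (X i) t)"
proof (induction n)
  case 0
  then show ?case by (simp add: char_def integral_return)
qed (simp add: char_convolution real_distribution_fin_conv assms)

lemma AE_fin_conv:
  fixes a :: "nat \<Rightarrow> real"
  assumes "\<And>n. real_distribution (X n)" "\<And>n. AE x in X n. x \<in> {0..a n}"
  shows "AE x in fin_conv X n. x \<in> {0..\<Sum>i<n. a i}"
proof (induction n)
  case 0
  show ?case by (subst fin_conv.simps, subst AE_return) auto
next
  case (Suc n)
  have "real_distribution (fin_conv X n)"
    by (intro real_distribution_fin_conv assms)
  from AE_convolution_atLeastAtMost[OF this assms(1) Suc.IH assms(2)]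
  show ?case by (simp only: fin_conv.simps sum.lessThan_Suc)
qed

text \<open>Multiplication by \<open>char (X n) t\<close> changes the partial product by at most
  \<open>\<bar>t\<bar> * a n\<close>, so the characteristic functions converge pointwise because
  \<open>a\<close> is summable. Tightness gives a limit law along a subsequence; its characteristic
  function must be the limit of the whole sequence, and Levy's continuity theorem then removes the
  subsequence.\<close>

lemma inf_conv_bounded:
  fixes a :: "nat \<Rightarrow> real"
  assumes X: "\<And>n. real_distribution (X n)" and supp: "\<And>n. AE x in X n. x \<in> {0..a n}"
    and bound: "\<And>n. (\<Sum>i<n. a i) \<le> c"
  shows "real_distribution (inf_conv X)"
    and "AE x in inf_conv X. x \<in> {0..c}"
    and "(\<lambda>n. \<Prod>i<n. char (X i) t) \<longlonglongrightarrow> char (inf_conv X) t"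
proof -
  note F = real_distribution_fin_conv[OF X]
  \<comment> \<open>A negative \<open>a n\<close> would leave the probability measure
    \<open>X n\<close> on an empty interval.\<close>
  have a: "a n \<ge> 0" for n
  proof (rule ccontr)
    interpret real_distribution "X n" by fact
    assume "\<not> a n \<ge> 0"
    then have "AE x in X n. False"
      using supp[of n] by simp
    then show False by simp
  qed
  have suppF: "AE x in fin_conv X n. x \<in> {0..c}" for n
    using AE_fin_conv[of X a n, OF X supp] by eventually_elim (use bound[of n] in auto)
  have "summable a"
    using a bound by (intro summableI_nonneg_bounded)
  have conv: "convergent (\<lambda>n. char (fin_conv X n) t)" for t
  proof -
    define p where "p n = char (fin_conv X n) t" for n
    have "norm (p (Suc n) - p n) \<le> \<bar>t\<bar> * a n" for n
    proof -
      interpret Xn: real_distribution "X n" by fact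
      interpret Fn: real_distribution "fin_conv X n" by (rule F)
      have "p (Suc n) - p n = p n * (char (X n) t - char (X n) 0)"
        by (simp add: p_def char_convolution F X Xn.char_zero algebra_simps)
      also have "norm \<dots> \<le> 1 * (\<bar>t - 0\<bar> * a n)"
        unfolding norm_mult p_def
        by (intro mult_mono Fn.cmod_char_le_1 norm_char_diff_le X supp) auto
      finally show ?thesis by simp
    qed
    then have "summable (\<lambda>n. p (Suc n) - p n)"
      by (rule summable_comparison_test'[where N = 0, OF summable_mult[OF \<open>summable a\<close>]])
    then show ?thesis
      by (unfold summable_iff_convergent sum_lessThan_telescope convergent_diff_const_right_iff)
        (unfold p_def)
  qed
  have tight: "tight (fin_conv X)"
    using F suppF by (rule tight_atLeastAtMost)
  obtain r M where r: "strict_mono (r :: nat \<Rightarrow> nat)" "real_distribution M" "weak_conv_m (fin_conv X \<circ> id \<circ> r) M"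
    using tight_imp_convergent_subsubsequence[OF tight strict_mono_id] by blast
  have lim: "(\<lambda>n. char (fin_conv X n) t) \<longlonglongrightarrow> char M t" for t
  proof -
    from conv[of t] obtain l where l: "(\<lambda>n. char (fin_conv X n) t) \<longlonglongrightarrow> l"
      by (auto simp: convergent_def)
    moreover have "(\<lambda>n. char (fin_conv X (r n)) t) \<longlonglongrightarrow> char M t"
      using levy_continuity1[of "\<lambda>n. fin_conv X (r n)" M t] r F by (simp add: comp_def)
    ultimately show ?thesis
      using LIMSEQ_subseq_LIMSEQ[OF l r(1)] LIMSEQ_unique by (auto simp: comp_def)
  qed
  then have weak: "weak_conv_m (fin_conv X) M"
    using F r(2) by (intro levy_continuity)
  have eq: "inf_conv X = M"
    using X r(2) weak by (rule inf_conv_eqI)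
  show "real_distribution (inf_conv X)"
    using r(2) eq by simp
  show "AE x in inf_conv X. x \<in> {0..c}"
    unfolding eq using F r(2) weak suppF by (rule AE_weak_limit_atLeastAtMost)
  show "(\<lambda>n. \<Prod>i<n. char (X i) t) \<longlonglongrightarrow> char (inf_conv X) t"
    using lim[of t] X by (simp add: eq char_fin_conv)
qed

lemma char_unif_dirac:
  assumes "finite A" "A \<noteq> {}"
  shows "char (unif_dirac A) t = (\<Sum>a\<in>A. cis (t * a)) / of_nat (card A)"
proof -
  have "char (unif_dirac A) t = (\<integral>x. cis (t * x) \<partial>measure_pmf (pmf_of_set A))"
    unfolding char_def unif_dirac_def by (subst integral_distr) (auto simp: cis_conv_exp)
  also have "\<dots> = (\<Sum>a\<in>A. pmf (pmf_of_set A) a *\<^sub>R cis (t * a))"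
    using assms by (intro integral_measure_pmf) auto
  also have "\<dots> = (\<Sum>a\<in>A. cis (t * a)) / of_nat (card A)"
    using assms by (simp add: sum_divide_distrib scaleR_conv_of_real)
  finally show ?thesis .
qed

lemma AE_unif_dirac:
  assumes "finite A" "A \<noteq> {}"
  shows "AE x in unif_dirac A. x \<in> A"
  using assms sets.countable[of A borel] unfolding unif_dirac_def
  by (subst AE_distr_iff) (auto simp: AE_measure_pmf_iff countable_finite)

section \<open>Density of trigonometric polynomials\<close>

text \<open>The inductive form lets closure properties be proved by rule induction;
  \<open>trig_eq_sum\<close> recovers explicit sums where the definition of a basis asks for
  them.\<close>

inductive_set trig :: "real set \<Rightarrow> (real \<Rightarrow> complex) set" for G where
  cis: "\<xi> \<in> G \<Longrightarrow> (\<lambda>x. cis (2 * pi * \<xi> * x)) \<in> trig G"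
| add: "f \<in> trig G \<Longrightarrow> g \<in> trig G \<Longrightarrow> (\<lambda>x. f x + g x) \<in> trig G"
| scale: "f \<in> trig G \<Longrightarrow> (\<lambda>x. c * f x) \<in> trig G"

lemma trig_const:
  assumes "0 \<in> G"
  shows "(\<lambda>x. c) \<in> trig G"
  using trig.scale[OF trig.cis[OF assms], of c] by simp

lemma trig_mult:
  assumes G: "\<And>a b. a \<in> G \<Longrightarrow> b \<in> G \<Longrightarrow> a + b \<in> G" and "f \<in> trig G" "g \<in> trig G"
  shows "(\<lambda>x. f x * g x) \<in> trig G"
  using assms(2)
proof induction
  case (cis \<xi>)
  show ?case
    using assms(3)
  proof induction
    case (cis \<eta>)
    have "(\<lambda>x. cis (2 * pi * \<xi> * x) * cis (2 * pi * \<eta> * x)) = (\<lambda>x. cis (2 * pi * (\<xi> + \<eta>) * x))"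
      by (simp add: cis_mult algebra_simps)
    then show ?case
      using trig.cis[OF G[OF \<open>\<xi> \<in> G\<close> cis]] by simp
  next
    case (add f g)
    then show ?case using trig.add[OF add.IH] by (simp add: distrib_left)
  next
    case (scale f c)
    then show ?case using trig.scale[OF scale.IH, of c] by (simp add: mult.left_commute)
  qed
next
  case (add f g)
  then show ?case using trig.add[OF add.IH] by (simp add: distrib_right)
next
  case (scale f c)
  then show ?case using trig.scale[OF scale.IH, of c] by (simp add: mult.assoc)
qed

lemma trig_continuous: "f \<in> trig G \<Longrightarrow> continuous_on A f"
  by (induction rule: trig.induct) (auto intro!: continuous_intros)

lemma trig_bounded: "f \<in> trig G \<Longrightarrow> \<exists>C. \<forall>x. cmod (f x) \<le> C"
proof (induction rule: trig.induct)
  case (add f g)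
  then obtain C D where "\<forall>x. cmod (f x) \<le> C" "\<forall>x. cmod (g x) \<le> D" by blast
  then show ?case
    by (intro exI[of _ "C + D"]) (auto intro: norm_triangle_le add_mono)
next
  case (scale f c)
  then obtain C where "\<forall>x. cmod (f x) \<le> C" by blast
  then show ?case
    by (intro exI[of _ "cmod c * C"]) (auto simp: norm_mult intro: mult_left_mono)
qed (auto intro: exI[of _ 1])

text \<open>Stone-Weierstrass is applied to the real and imaginary parts, in the ring of those real
  functions on \<open>S\<close> whose composition with \<open>p\<close> is a trigonometric
  polynomial. The map \<open>p\<close> is the identity for the interval and the winding map for the
  circle.\<close>

lemma trig_dense:
  fixes p :: "real \<Rightarrow> 'a::t2_space" and f :: "'a \<Rightarrow> complex"
  assumes S: "compact S" and G0: "0 \<in> G" and G: "\<And>a b. a \<in> G \<Longrightarrow> b \<in> G \<Longrightarrow> a + b \<in> G"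
    and sep: "\<And>x y. x \<in> S \<Longrightarrow> y \<in> S \<Longrightarrow> x \<noteq> y \<Longrightarrow>
      \<exists>f. continuous_on S f \<and> (\<lambda>t. complex_of_real (f (p t))) \<in> trig G \<and> f x \<noteq> f y"
    and f: "continuous_on S f" and e: "e > 0"
  shows "\<exists>g\<in>trig G. \<forall>t. p t \<in> S \<longrightarrow> cmod (f (p t) - g t) < e"
proof -
  interpret R: function_ring_on "{f. continuous_on S f \<and> (\<lambda>t. complex_of_real (f (p t))) \<in> trig G}" S
  proof
    fix c :: real
    show "(\<lambda>_. c) \<in> {f. continuous_on S f \<and> (\<lambda>t. complex_of_real (f (p t))) \<in> trig G}"
      using trig_const[OF G0] by (auto intro: continuous_intros)
  next
    fix x y assume "x \<in> S" "y \<in> S" "x \<noteq> y"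
    then show "\<exists>f\<in>{f. continuous_on S f \<and> (\<lambda>t. complex_of_real (f (p t))) \<in> trig G}. f x \<noteq> f y"
      using sep by blast
  qed (use S in \<open>auto intro: continuous_intros trig.add trig_mult[OF G]\<close>)
  have "continuous_on S (\<lambda>x. Re (f x))" "continuous_on S (\<lambda>x. Im (f x))"
    using f by (auto intro: continuous_intros)
  from R.Stone_Weierstrass_basic[OF this(1), of "e / 2"] R.Stone_Weierstrass_basic[OF this(2), of "e / 2"] e
  obtain u v where u: "(\<lambda>t. complex_of_real (u (p t))) \<in> trig G" "\<And>x. x \<in> S \<Longrightarrow> \<bar>Re (f x) - u x\<bar> < e / 2"
    and v: "(\<lambda>t. complex_of_real (v (p t))) \<in> trig G" "\<And>x. x \<in> S \<Longrightarrow> \<bar>Im (f x) - v x\<bar> < e / 2"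
    by auto
  show ?thesis
  proof (intro bexI allI impI)
    show "(\<lambda>t. complex_of_real (u (p t)) + \<i> * complex_of_real (v (p t))) \<in> trig G"
      by (intro trig.add trig.scale u v)
    fix t assume "p t \<in> S"
    then show "cmod (f (p t) - (complex_of_real (u (p t)) + \<i> * complex_of_real (v (p t)))) < e"
      using cmod_le[of "f (p t) - (complex_of_real (u (p t)) + \<i> * complex_of_real (v (p t)))"] u(2)[of "p t"] v(2)[of "p t"]
      by simp
  qed
qed

lemma trig_dense_interval:
  fixes f :: "real \<Rightarrow> complex"
  assumes "continuous_on {0..1} f" "e > 0"
  shows "\<exists>g\<in>trig UNIV. \<forall>t\<in>{0..1}. cmod (f t - g t) < e"
proof -
  \<comment> \<open>The frequencies \<open>1 / (2 * pi)\<close> and \<open>- 1 / (2 * pi)\<close>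
    produce \<open>sin t\<close>, which alone separates the points of [0, 1].\<close>
  have "(\<lambda>t. (1 / (2 * \<i>)) * cis (2 * pi * (1 / (2 * pi)) * t) + (- 1 / (2 * \<i>)) * cis (2 * pi * (- 1 / (2 * pi)) * t)) \<in> trig UNIV"
    by (intro trig.intros) auto
  also have "(\<lambda>t. (1 / (2 * \<i>)) * cis (2 * pi * (1 / (2 * pi)) * t) + (- 1 / (2 * \<i>)) * cis (2 * pi * (- 1 / (2 * pi)) * t))
      = (\<lambda>t. complex_of_real (sin t))"
    by (auto simp: complex_eq_iff divide_simps)
  finally have sin: "(\<lambda>t. complex_of_real (sin t)) \<in> trig UNIV" .
  have "\<exists>g\<in>trig UNIV. \<forall>t. t \<in> {0..1} \<longrightarrow> cmod (f t - g t) < e"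
  proof (rule trig_dense[where p = "\<lambda>t. t"])
    fix x y :: real assume xy: "x \<in> {0..1}" "y \<in> {0..1}" "x \<noteq> y"
    have "- (pi / 2) \<le> x" "x \<le> pi / 2" "- (pi / 2) \<le> y" "y \<le> pi / 2"
      using xy pi_gt3 by auto
    then have "sin x \<noteq> sin y"
      using sin_inj_pi[of x y] xy by auto
    then show "\<exists>f. continuous_on {0..1} f \<and> (\<lambda>t. complex_of_real (f t)) \<in> trig UNIV \<and> f x \<noteq> f y"
      using sin by (intro exI[of _ sin]) (auto intro: continuous_intros)
  qed (use assms in auto)
  then show ?thesis by blast
qed

text \<open>Integer frequencies suffice on the circle: the frequencies 1 and -1 already give the two
  coordinates, which separate points.\<close>

lemma trig_dense_circle:
  fixes f :: "complex \<Rightarrow> complex"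
  assumes "continuous_on (sphere 0 1) f" "e > 0"
  shows "\<exists>g\<in>trig \<int>. \<forall>t. cmod (f (cis (2 * pi * t)) - g t) < e"
proof -
  let ?a = "\<lambda>t. cis (2 * pi * 1 * t)" and ?b = "\<lambda>t. cis (2 * pi * (- 1) * t)"
  have "(\<lambda>t. (1 / 2) * ?a t + (1 / 2) * ?b t) \<in> trig \<int>"
    by (intro trig.intros) auto
  also have "(\<lambda>t. (1 / 2) * ?a t + (1 / 2) * ?b t) = (\<lambda>t. complex_of_real (Re (cis (2 * pi * t))))"
    by (auto simp: complex_eq_iff)
  finally have Re: "(\<lambda>t. complex_of_real (Re (cis (2 * pi * t)))) \<in> trig \<int>" .
  have "(\<lambda>t. (1 / (2 * \<i>)) * ?a t + (- 1 / (2 * \<i>)) * ?b t) \<in> trig \<int>"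
    by (intro trig.intros) auto
  also have "(\<lambda>t. (1 / (2 * \<i>)) * ?a t + (- 1 / (2 * \<i>)) * ?b t) = (\<lambda>t. complex_of_real (Im (cis (2 * pi * t))))"
    by (auto simp: complex_eq_iff divide_simps)
  finally have Im: "(\<lambda>t. complex_of_real (Im (cis (2 * pi * t)))) \<in> trig \<int>" .
  have "\<exists>g\<in>trig \<int>. \<forall>t. cis (2 * pi * t) \<in> sphere 0 1 \<longrightarrow> cmod (f (cis (2 * pi * t)) - g t) < e"
  proof (rule trig_dense[where p = "\<lambda>t. cis (2 * pi * t)"])
    fix x y :: complex assume "x \<noteq> y"
    then consider "Re x \<noteq> Re y" | "Im x \<noteq> Im y"
      by (auto simp: complex_eq_iff)
    then show "\<exists>f. continuous_on (sphere 0 1) f \<and> (\<lambda>t. complex_of_real (f (cis (2 * pi * t)))) \<in> trig \<int> \<and> f x \<noteq> f y"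
      by cases (rule exI[of _ Re] exI[of _ Im], use Re Im in \<open>force intro: continuous_intros\<close>)+
  qed (use assms in auto)
  then show ?thesis by simp
qed

section \<open>Closures in the space of square-integrable functions\<close>

lemma L2_fun_measurable: "f \<in> L2_fun M \<Longrightarrow> f \<in> borel_measurable M"
  by (simp add: L2_fun_def)

lemma L2_fun_bounded:
  assumes "finite_measure M" "f \<in> borel_measurable M" "\<And>x. cmod (f x) \<le> C"
  shows "f \<in> L2_fun M"
proof -
  interpret finite_measure M by fact
  have "(cmod (f x))\<^sup>2 \<le> C\<^sup>2" for x
    using assms(3) by (intro power_mono) auto
  then show ?thesis
    using assms(2) by (auto simp: L2_fun_def intro!: integrable_const_bound[of _ "C\<^sup>2"])
qed

lemma norm_add_sq_le: "(norm (a + b))\<^sup>2 \<le> 2 * (norm a)\<^sup>2 + 2 * (norm b)\<^sup>2"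
  for a b :: "'a::real_normed_vector"
proof -
  have "(norm (a + b))\<^sup>2 \<le> (norm a + norm b)\<^sup>2"
    by (intro power_mono norm_triangle_ineq) auto
  also have "\<dots> \<le> 2 * (norm a)\<^sup>2 + 2 * (norm b)\<^sup>2"
    using sum_squares_bound[of "norm a" "norm b"] by (simp add: power2_sum)
  finally show ?thesis .
qed

lemma L2_fun_add:
  assumes "f \<in> L2_fun M" "g \<in> L2_fun M"
  shows "(\<lambda>x. f x + g x) \<in> L2_fun M"
proof -
  have [measurable]: "f \<in> borel_measurable M" "g \<in> borel_measurable M"
    using assms by (auto simp: L2_fun_def)
  have "integrable M (\<lambda>x. 2 * (cmod (f x))\<^sup>2 + 2 * (cmod (g x))\<^sup>2)"
    using assms by (auto simp: L2_fun_def)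
  then have "integrable M (\<lambda>x. (cmod (f x + g x))\<^sup>2)"
    by (rule Bochner_Integration.integrable_bound) (auto simp: norm_add_sq_le)
  then show ?thesis by (simp add: L2_fun_def)
qed

lemma L2_fun_mult_const:
  assumes "f \<in> L2_fun M"
  shows "(\<lambda>x. c * f x) \<in> L2_fun M"
  using assms by (auto simp: L2_fun_def norm_mult power_mult_distrib)

lemma L2_fun_diff:
  assumes "f \<in> L2_fun M" "g \<in> L2_fun M"
  shows "(\<lambda>x. f x - g x) \<in> L2_fun M"
  using L2_fun_add[OF assms(1) L2_fun_mult_const[OF assms(2), of "- 1"]] by simp

text \<open>Working with the square avoids roots; the triangle inequality with factors 2 is enough
  for closure arguments.\<close>

definition L2_dist_sq :: "'a measure \<Rightarrow> ('a \<Rightarrow> complex) \<Rightarrow> ('a \<Rightarrow> complex) \<Rightarrow> real" where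
  "L2_dist_sq M f g = (\<integral>x. (cmod (f x - g x))\<^sup>2 \<partial>M)"

lemma L2_dist_sq_add_le:
  assumes "f \<in> L2_fun M" "f' \<in> L2_fun M" "g \<in> L2_fun M" "g' \<in> L2_fun M"
  shows "L2_dist_sq M (\<lambda>x. f x + f' x) (\<lambda>x. g x + g' x) \<le> 2 * L2_dist_sq M f g + 2 * L2_dist_sq M f' g'"
proof -
  have int: "integrable M (\<lambda>x. (cmod (f x - g x))\<^sup>2)" "integrable M (\<lambda>x. (cmod (f' x - g' x))\<^sup>2)"
     "integrable M (\<lambda>x. (cmod ((f x + f' x) - (g x + g' x)))\<^sup>2)"
    using L2_fun_diff[OF assms(1,3)] L2_fun_diff[OF assms(2,4)] L2_fun_diff[OF L2_fun_add[OF assms(1,2)] L2_fun_add[OF assms(3,4)]]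
    by (auto simp: L2_fun_def)
  have "L2_dist_sq M (\<lambda>x. f x + f' x) (\<lambda>x. g x + g' x) \<le>
      (\<integral>x. 2 * (cmod (f x - g x))\<^sup>2 + 2 * (cmod (f' x - g' x))\<^sup>2 \<partial>M)"
    unfolding L2_dist_sq_def
  proof (rule integral_mono)
    fix x
    show "(cmod ((f x + f' x) - (g x + g' x)))\<^sup>2 \<le> 2 * (cmod (f x - g x))\<^sup>2 + 2 * (cmod (f' x - g' x))\<^sup>2"
      using norm_add_sq_le[of "f x - g x" "f' x - g' x"] by (simp add: algebra_simps)
  qed (use int in auto)
  also have "\<dots> = 2 * L2_dist_sq M f g + 2 * L2_dist_sq M f' g'"
    using int by (simp add: L2_dist_sq_def)
  finally show ?thesis .
qed

lemma L2_dist_sq_triangle: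
  assumes "f \<in> L2_fun M" "g \<in> L2_fun M" "h \<in> L2_fun M"
  shows "L2_dist_sq M f h \<le> 2 * L2_dist_sq M f g + 2 * L2_dist_sq M g h"
proof -
  \<comment> \<open>The difference of \<open>f + g\<close> and \<open>h + g\<close> is
    \<open>f - h\<close>, so the bound for sums applies to the pairs \<open>f\<close>,
    \<open>g\<close> and \<open>g\<close>, \<open>h\<close>.\<close>
  have "L2_dist_sq M (\<lambda>x. f x + g x) (\<lambda>x. h x + g x) \<le> 2 * L2_dist_sq M f g + 2 * L2_dist_sq M g h"
    using L2_dist_sq_add_le[OF assms(1,2,2,3)] by (simp add: add.commute)
  then show ?thesis by (simp add: L2_dist_sq_def)
qed

definition L2_closure :: "'a measure \<Rightarrow> ('a \<Rightarrow> complex) set \<Rightarrow> ('a \<Rightarrow> complex) set" where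
  "L2_closure M V = {f \<in> L2_fun M. \<forall>e>0. \<exists>g\<in>V. L2_dist_sq M f g < e}"

lemma L2_closureE:
  assumes "f \<in> L2_closure M V" "e > 0"
  obtains g where "g \<in> V" "L2_dist_sq M f g < e"
  using assms by (auto simp: L2_closure_def)

lemma L2_closure_superset: "V \<subseteq> L2_fun M \<Longrightarrow> V \<subseteq> L2_closure M V"
  unfolding L2_closure_def by (force simp: L2_dist_sq_def)

lemma L2_closure_idem:
  assumes V: "V \<subseteq> L2_fun M" and W: "W \<subseteq> L2_closure M V"
  shows "L2_closure M W \<subseteq> L2_closure M V"
proof
  fix f assume f: "f \<in> L2_closure M W"
  have "\<exists>h\<in>V. L2_dist_sq M f h < e" if "e > 0" for e
  proof -
    have "e / 4 > 0" using that by simp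
    obtain g where g: "g \<in> W" "L2_dist_sq M f g < e / 4"
      using L2_closureE[OF f \<open>e / 4 > 0\<close>] by blast
    obtain h where h: "h \<in> V" "L2_dist_sq M g h < e / 4"
      using L2_closureE[of g M V "e / 4"] g(1) W \<open>e / 4 > 0\<close> by blast
    have "L2_dist_sq M f h \<le> 2 * L2_dist_sq M f g + 2 * L2_dist_sq M g h"
      using f g(1) h(1) V W by (intro L2_dist_sq_triangle) (auto simp: L2_closure_def)
    then show ?thesis
      using g(2) h by (intro bexI[of _ h]) auto
  qed
  then show "f \<in> L2_closure M V"
    using f by (auto simp: L2_closure_def)
qed

lemma L2_closure_add:
  assumes V: "V \<subseteq> L2_fun M" and add: "\<And>f g. f \<in> V \<Longrightarrow> g \<in> V \<Longrightarrow> (\<lambda>x. f x + g x) \<in> V"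
    and f: "f \<in> L2_closure M V" and f': "f' \<in> L2_closure M V"
  shows "(\<lambda>x. f x + f' x) \<in> L2_closure M V"
  unfolding L2_closure_def
proof (intro CollectI conjI allI impI)
  show "(\<lambda>x. f x + f' x) \<in> L2_fun M"
    using f f' by (auto simp: L2_closure_def intro: L2_fun_add)
  fix e :: real assume "e > 0"
  then have "e / 4 > 0" by simp
  obtain g where g: "g \<in> V" "L2_dist_sq M f g < e / 4"
    using L2_closureE[OF f \<open>e / 4 > 0\<close>] by blast
  obtain g' where g': "g' \<in> V" "L2_dist_sq M f' g' < e / 4"
    using L2_closureE[OF f' \<open>e / 4 > 0\<close>] by blast
  have "L2_dist_sq M (\<lambda>x. f x + f' x) (\<lambda>x. g x + g' x) \<le> 2 * L2_dist_sq M f g + 2 * L2_dist_sq M f' g'"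
    using f f' g(1) g'(1) V by (intro L2_dist_sq_add_le) (auto simp: L2_closure_def)
  then show "\<exists>g\<in>V. L2_dist_sq M (\<lambda>x. f x + f' x) g < e"
    using g g' add by (intro bexI[of _ "\<lambda>x. g x + g' x"]) auto
qed

lemma L2_closure_scale:
  assumes scale: "\<And>f c. f \<in> V \<Longrightarrow> (\<lambda>x. c * f x) \<in> V"
    and f: "f \<in> L2_closure M V"
  shows "(\<lambda>x. c * f x) \<in> L2_closure M V"
  unfolding L2_closure_def
proof (intro CollectI conjI allI impI)
  show "(\<lambda>x. c * f x) \<in> L2_fun M"
    using f by (auto simp: L2_closure_def intro: L2_fun_mult_const)
  fix e :: real assume "e > 0"
  define d where "d = e / ((cmod c)\<^sup>2 + 1)"
  have pos: "(cmod c)\<^sup>2 + 1 > 0" by (simp add: add_nonneg_pos)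
  then have "d > 0" using \<open>e > 0\<close> by (simp add: d_def)
  then obtain g where g: "g \<in> V" "L2_dist_sq M f g < d"
    using f by (auto simp: L2_closure_def)
  have "L2_dist_sq M (\<lambda>x. c * f x) (\<lambda>x. c * g x) = (cmod c)\<^sup>2 * L2_dist_sq M f g"
    by (simp add: L2_dist_sq_def norm_mult power_mult_distrib flip: right_diff_distrib)
  also have "\<dots> \<le> (cmod c)\<^sup>2 * d"
    using g by (intro mult_left_mono) auto
  also have "\<dots> < ((cmod c)\<^sup>2 + 1) * d"
    using \<open>d > 0\<close> by (simp add: distrib_right)
  also have "\<dots> = e"
    using pos by (simp add: d_def)
  finally show "\<exists>g\<in>V. L2_dist_sq M (\<lambda>x. c * f x) g < e"
    using scale[OF g(1), of c] by blast
qed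

text \<open>Since both \<open>f n\<close> and \<open>g\<close> are bounded by \<open>w\<close>, the
  squared difference is dominated by \<open>4 * w\<^sup>2\<close>. The lemma carries each limit
  passage in \<open>L2_closure_trig_UNIV\<close>.\<close>

lemma L2_closure_dominated:
  assumes V: "V \<subseteq> L2_fun M"
    and f: "\<And>n. f n \<in> L2_closure M V" and g: "g \<in> borel_measurable M"
    and lim: "\<And>x. x \<in> space M \<Longrightarrow> (\<lambda>n. f n x) \<longlonglongrightarrow> g x"
    and w: "integrable M (\<lambda>x. (w x)\<^sup>2)" and bound: "\<And>n x. x \<in> space M \<Longrightarrow> cmod (f n x) \<le> w x"
  shows "g \<in> L2_closure M V"
proof -
  have f_L2: "f n \<in> L2_fun M" for n
    using f by (simp add: L2_closure_def)
  then have [measurable]: "f n \<in> borel_measurable M" for n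
    by (rule L2_fun_measurable)
  note [measurable] = g
  have g_bound: "cmod (g x) \<le> w x" if "x \<in> space M" for x
    using bound[OF that] tendsto_norm[OF lim[OF that]] by (intro LIMSEQ_le_const2) auto
  have "integrable M (\<lambda>x. (cmod (g x))\<^sup>2)"
    by (rule Bochner_Integration.integrable_bound[OF w]) (auto intro!: power_mono AE_I2 g_bound)
  then have "g \<in> L2_fun M"
    using g by (simp add: L2_fun_def)
  have "(\<lambda>n. L2_dist_sq M g (f n)) \<longlonglongrightarrow> (\<integral>x. 0 \<partial>M)"
    unfolding L2_dist_sq_def
  proof (rule integral_dominated_convergence)
    show "integrable M (\<lambda>x. 4 * (w x)\<^sup>2)"
      using w by simp
    show "AE x in M. (\<lambda>n. (cmod (g x - f n x))\<^sup>2) \<longlonglongrightarrow> 0"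
    proof (rule AE_I2)
      fix x assume "x \<in> space M"
      from lim[OF this] have "(\<lambda>n. (cmod (g x - f n x))\<^sup>2) \<longlonglongrightarrow> (cmod (g x - g x))\<^sup>2"
        by (intro tendsto_intros)
      then show "(\<lambda>n. (cmod (g x - f n x))\<^sup>2) \<longlonglongrightarrow> 0" by simp
    qed
    show "AE x in M. norm ((cmod (g x - f n x))\<^sup>2) \<le> 4 * (w x)\<^sup>2" for n
    proof (rule AE_I2)
      fix x assume x: "x \<in> space M"
      have "cmod (g x - f n x) \<le> 2 * w x"
        using g_bound[OF x] bound[OF x, of n] norm_triangle_ineq4[of "g x" "f n x"] by linarith
      then have "(cmod (g x - f n x))\<^sup>2 \<le> (2 * w x)\<^sup>2"
        by (intro power_mono) auto
      then show "norm ((cmod (g x - f n x))\<^sup>2) \<le> 4 * (w x)\<^sup>2"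
        by (simp add: power_mult_distrib)
    qed
  qed measurable
  then have lim0: "(\<lambda>n. L2_dist_sq M g (f n)) \<longlonglongrightarrow> 0" by simp
  have "\<exists>h\<in>range f. L2_dist_sq M g h < e" if "e > 0" for e
    using order_tendstoD(2)[OF lim0 that] by (auto dest: eventually_happens)
  then have "g \<in> L2_closure M (range f)"
    using \<open>g \<in> L2_fun M\<close> by (simp add: L2_closure_def)
  then show ?thesis
    using L2_closure_idem[OF V, of "range f"] f by blast
qed

lemma trig_L2_fun:
  assumes "real_distribution M" "f \<in> trig G"
  shows "f \<in> L2_fun M"
proof -
  interpret real_distribution M by fact
  from trig_bounded[OF assms(2)] obtain C where "\<And>x. cmod (f x) \<le> C" by blast
  moreover have "f \<in> borel_measurable borel"
    using trig_continuous[OF assms(2)] by (rule borel_measurable_continuous_onI)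
  ultimately show ?thesis
    by (intro L2_fun_bounded) (auto intro: finite_measure_axioms)
qed

text \<open>Bounded continuous functions are uniformly approximable on [0, 1], which carries
  \<open>M\<close>. From there the closure is enlarged to indicators of half lines, to indicators of
  Borel sets, to simple functions and finally to all of \<open>L2_fun M\<close>.\<close>

lemma L2_closure_trig_UNIV:
  assumes "real_distribution M" and supp: "AE x in M. x \<in> {0..1}"
  shows "L2_closure M (trig UNIV) = L2_fun M"
proof
  interpret real_distribution M by fact
  let ?C = "L2_closure M (trig UNIV)"
  have V: "trig UNIV \<subseteq> L2_fun M"
    using trig_L2_fun[OF assms(1)] by blast
  note C_add = L2_closure_add[OF V trig.add] and C_scale = L2_closure_scale[OF trig.scale]
  have C_const: "(\<lambda>x. c) \<in> ?C" for c
    using L2_closure_superset[OF V] trig_const[of UNIV c] by blast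
  have C_sum: "(\<lambda>x. \<Sum>i\<in>I. f i x) \<in> ?C" if "finite I" "\<And>i. i \<in> I \<Longrightarrow> f i \<in> ?C" for I :: "'b set" and f
    using that by (induction I rule: finite_induct) (auto intro: C_add C_const)
  have C_cont: "f \<in> ?C" if cont: "continuous_on UNIV f" and bound: "\<And>x. cmod (f x) \<le> K" for f K
    unfolding L2_closure_def
  proof (intro CollectI conjI allI impI)
    have [measurable]: "f \<in> borel_measurable borel"
      using cont by (rule borel_measurable_continuous_onI)
    show "f \<in> L2_fun M"
      using bound by (intro L2_fun_bounded) (auto intro: finite_measure_axioms)
    fix e :: real assume "e > 0"
    obtain g where g: "g \<in> trig UNIV" "\<And>t. t \<in> {0..1} \<Longrightarrow> cmod (f t - g t) < sqrt (e / 2)"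
      using trig_dense_interval[of f "sqrt (e / 2)"] \<open>e > 0\<close> continuous_on_subset[OF cont] by auto
    have [measurable]: "g \<in> borel_measurable borel"
      using trig_continuous[OF g(1)] by (rule borel_measurable_continuous_onI)
    have "L2_dist_sq M f g \<le> (\<integral>x. e / 2 \<partial>M)"
      unfolding L2_dist_sq_def
    proof (rule integral_mono_AE)
      have "(\<lambda>x. f x - g x) \<in> L2_fun M"
        using \<open>f \<in> L2_fun M\<close> g(1) V by (intro L2_fun_diff) auto
      then show "integrable M (\<lambda>x. (cmod (f x - g x))\<^sup>2)"
        by (simp add: L2_fun_def)
      show "AE x in M. (cmod (f x - g x))\<^sup>2 \<le> e / 2"
        using supp
      proof eventually_elim
        case (elim x)
        have "(cmod (f x - g x))\<^sup>2 \<le> (sqrt (e / 2))\<^sup>2"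
          using g(2)[OF elim] by (intro power_mono) auto
        then show ?case using \<open>e > 0\<close> by simp
      qed
    qed simp
    also have "\<dots> < e"
      using \<open>e > 0\<close> by (simp add: prob_space del: space_eq_univ)
    finally show "\<exists>g\<in>trig UNIV. L2_dist_sq M f g < e"
      using g(1) by blast
  qed
  \<comment> \<open>The cutoffs that fall from 1 to 0 on \<open>[a, a + 1 / (n + 1)]\<close> are
    continuous and converge pointwise to the indicator.\<close>
  have C_atMost: "(\<lambda>x. indicator {..a} x) \<in> ?C" for a :: real
  proof (rule L2_closure_dominated[OF V, where w = "\<lambda>_. 1"])
    let ?f = "\<lambda>n x. complex_of_real (cts_step a (a + 1 / real (Suc n)) x)"
    show "?f n \<in> ?C" for n
    proof (rule C_cont)
      show "continuous_on UNIV (?f n)"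
        by (intro continuous_intros uniformly_continuous_imp_continuous cts_step_uniformly_continuous) simp
      show "cmod (?f n x) \<le> 1" for x
        by (auto simp: cts_step_def divide_simps)
    qed
    show "cmod (?f n x) \<le> 1" for n x
      by (auto simp: cts_step_def divide_simps)
    fix x
    show "(\<lambda>n. ?f n x) \<longlonglongrightarrow> indicator {..a} x"
    proof (cases "x \<le> a")
      case False
      then have "eventually (\<lambda>n. 1 / real (Suc n) < x - a) sequentially"
        using order_tendstoD(2)[OF LIMSEQ_inverse_real_of_nat, of "x - a"] by (simp add: inverse_eq_divide)
      then have "eventually (\<lambda>n. ?f n x = indicator {..a} x) sequentially"
        by eventually_elim (use False in \<open>auto simp: cts_step_def\<close>)
      then show ?thesis by (rule tendsto_eventually)
    qed (simp add: cts_step_def)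
  qed auto
  have C_ind: "(\<lambda>x. indicator A x) \<in> ?C" if "A \<in> sets borel" for A :: "real set"
  proof -
    \<comment> \<open>Dynkin's argument: half lines form a generator stable under intersections, so
      only complements and disjoint countable unions need to be treated.\<close>
    have A: "A \<in> sigma_sets UNIV (range (\<lambda>a. {..a}))"
      using that by (simp add: borel_eq_atMost)
    have "Int_stable (range (\<lambda>a::real. {..a}))"
      by (auto simp: Int_stable_def)
    moreover have "range (\<lambda>a::real. {..a}) \<subseteq> Pow UNIV"
      by simp
    ultimately show ?thesis
      using A
    proof (induction rule: sigma_sets_induct_disjoint)
      case (compl A)
      have "(\<lambda>x. 1 + (- 1) * indicator A x) \<in> ?C"
        by (intro C_add C_const C_scale compl.IH)
      also have "(\<lambda>x. 1 + (- 1) * indicator A x) = (\<lambda>x. indicator (UNIV - A) x :: complex)"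
        by (auto simp: indicator_def)
      finally show ?case .
    next
      case (union A)
      have A: "A i \<in> sets borel" for i
        using union.hyps(2) by (auto simp: borel_eq_atMost)
      have eq: "(\<Sum>i<n. indicator (A i) x) = (indicator (\<Union>i<n. A i) x :: complex)" for n x
        using union.hyps(1) by (subst indicator_UN_disjoint) (auto simp: disjoint_family_on_def)
      show ?case
      proof (rule L2_closure_dominated[OF V, where w = "\<lambda>_. 1"])
        show "(\<lambda>x. \<Sum>i<n. indicator (A i) x) \<in> ?C" for n
          using union.IH by (intro C_sum) auto
        show "cmod (\<Sum>i<n. indicator (A i) x) \<le> 1" for n x
          unfolding eq by (simp add: indicator_def)
        show "(\<lambda>n. \<Sum>i<n. indicator (A i) x) \<longlonglongrightarrow> (indicator (\<Union>i. A i) x :: complex)" for x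
          unfolding eq by (rule LIMSEQ_indicator_UN)
      qed (use A in auto)
    next
      case empty
      then show ?case using C_const[of 0] by simp
    qed (auto simp: C_atMost)
  qed
  show "L2_fun M \<subseteq> ?C"
  proof
    fix f assume f: "f \<in> L2_fun M"
    then have [measurable]: "f \<in> borel_measurable M" by (rule L2_fun_measurable)
    from borel_measurable_implies_sequence_metric[OF this, of 0]
    obtain s where s: "\<And>i. simple_function M (s i)" "\<And>x. (\<lambda>i. s i x) \<longlonglongrightarrow> f x"
      "\<And>i x. cmod (s i x) \<le> 2 * cmod (f x)"
      by auto
    show "f \<in> ?C"
    proof (rule L2_closure_dominated[OF V, where f = s])
      fix i
      have "(\<lambda>x. \<Sum>y\<in>s i ` UNIV. y * indicator (s i -` {y}) x) \<in> ?C"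
      proof (intro C_sum C_scale C_ind)
        show "finite (range (s i))"
          using simple_functionD(1)[OF s(1)] by simp
        show "s i -` {y} \<in> sets borel" for y
          using simple_functionD(2)[OF s(1), of i "{y}"] by simp
      qed
      also have "(\<lambda>x. \<Sum>y\<in>s i ` UNIV. y * indicator (s i -` {y}) x) = s i"
      proof
        fix x
        have "s i x = (\<Sum>y\<in>s i ` space M. indicator (s i -` {y} \<inter> space M) x *\<^sub>R y)"
          by (rule simple_function_indicator_representation_banach[OF s(1)]) simp
        also have "\<dots> = (\<Sum>y\<in>s i ` UNIV. y * indicator (s i -` {y}) x)"
          by (intro sum.cong) (auto simp: indicator_def)
        finally show "(\<Sum>y\<in>s i ` UNIV. y * indicator (s i -` {y}) x) = s i x" ..
      qed
      finally show "s i \<in> ?C" .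
      show "integrable M (\<lambda>x. (2 * cmod (f x))\<^sup>2)"
        using f by (simp add: L2_fun_def power_mult_distrib)
    qed (use s in auto)
  qed
qed (auto simp: L2_closure_def)

section \<open>From Parseval's identity for exponentials to a spectrum\<close>

lemma trig_sum:
  assumes "finite F" "F \<subseteq> G" "G \<noteq> {}"
  shows "(\<lambda>x. \<Sum>\<xi>\<in>F. c \<xi> * cis (2 * pi * \<xi> * x)) \<in> trig G"
  using assms(1,2)
proof (induction F rule: finite_induct)
  case empty
  obtain \<xi> where "\<xi> \<in> G" using assms(3) by blast
  from trig.scale[OF trig.cis[OF this], of 0] show ?case by simp
next
  case (insert \<xi> F)
  then show ?case
    by (simp add: trig.add[OF trig.scale[OF trig.cis]])
qed

lemma trig_eq_sum:
  assumes "f \<in> trig G"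
  shows "\<exists>F c. finite F \<and> F \<subseteq> G \<and> f = (\<lambda>x. \<Sum>\<xi>\<in>F. c \<xi> * cis (2 * pi * \<xi> * x))"
  using assms
proof induction
  case (cis \<xi>)
  then show ?case
    by (intro exI[of _ "{\<xi>}"] exI[of _ "\<lambda>_. 1"]) simp
next
  case (add f g)
  then obtain F c F' c' where F: "finite F" "F \<subseteq> G" "f = (\<lambda>x. \<Sum>\<xi>\<in>F. c \<xi> * cis (2 * pi * \<xi> * x))"
    and F': "finite F'" "F' \<subseteq> G" "g = (\<lambda>x. \<Sum>\<xi>\<in>F'. c' \<xi> * cis (2 * pi * \<xi> * x))"
    by blast
  \<comment> \<open>A frequency that occurs in both sums receives both coefficients.\<close>
  define d where "d \<xi> = (if \<xi> \<in> F then c \<xi> else 0) + (if \<xi> \<in> F' then c' \<xi> else 0)" for \<xi>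
  have "(\<Sum>\<xi>\<in>F \<union> F'. d \<xi> * cis (2 * pi * \<xi> * x)) = f x + g x" for x
  proof -
    have "(\<Sum>\<xi>\<in>F \<union> F'. d \<xi> * cis (2 * pi * \<xi> * x)) =
        (\<Sum>\<xi>\<in>F \<union> F'. if \<xi> \<in> F then c \<xi> * cis (2 * pi * \<xi> * x) else 0) +
        (\<Sum>\<xi>\<in>F \<union> F'. if \<xi> \<in> F' then c' \<xi> * cis (2 * pi * \<xi> * x) else 0)"
      unfolding sum.distrib[symmetric] by (intro sum.cong refl) (simp add: d_def distrib_right)
    also have "\<dots> = f x + g x"
      using F(1) F'(1) by (simp add: F(3) F'(3) sum.If_cases Int_absorb1 Int_absorb2 Int_Un_distrib2 Un_absorb1 Un_absorb2 Int_commute)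
    finally show ?thesis .
  qed
  then have "(\<lambda>x. f x + g x) = (\<lambda>x. \<Sum>\<xi>\<in>F \<union> F'. d \<xi> * cis (2 * pi * \<xi> * x))"
    by simp
  then show ?case
    using F(1,2) F'(1,2) by (intro exI[of _ "F \<union> F'"] exI[of _ d]) auto
next
  case (scale f c)
  then obtain F d where F: "finite F" "F \<subseteq> G" "f = (\<lambda>x. \<Sum>\<xi>\<in>F. d \<xi> * cis (2 * pi * \<xi> * x))"
    by blast
  then show ?case
    by (intro exI[of _ F] exI[of _ "\<lambda>\<xi>. c * d \<xi>"]) (simp add: sum_distrib_left mult.assoc)
qed

lemma ft_uminus: "ft M (- \<xi>) = cnj (ft M \<xi>)"
proof -
  have "ft M (- \<xi>) = (\<integral>x. cnj (cis (2 * pi * \<xi> * x)) \<partial>M)"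
    unfolding ft_eq_integral by (intro Bochner_Integration.integral_cong refl) (simp add: cis_cnj)
  then show ?thesis
    by (simp only: Bochner_Integration.integral_cnj ft_eq_integral)
qed

text \<open>The coefficient \<open>ft M (\<xi> - a)\<close> is the inner product of the two
  exponentials, so the sum is the orthogonal projection onto the span of \<open>F\<close>. Expanding
  the square gives one minus the Parseval sum.\<close>

lemma L2_dist_sq_cis_projection:
  assumes "real_distribution M" "finite F"
    and orth: "\<And>a b. a \<in> F \<Longrightarrow> b \<in> F \<Longrightarrow> ft M (a - b) = (if a = b then 1 else 0)"
  shows "L2_dist_sq M (\<lambda>x. cis (2 * pi * \<xi> * x)) (\<lambda>x. \<Sum>a\<in>F. ft M (\<xi> - a) * cis (2 * pi * a * x)) =
    1 - (\<Sum>a\<in>F. (cmod (ft M (\<xi> - a)))\<^sup>2)"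
proof -
  interpret real_distribution M by fact
  define c where "c a = ft M (\<xi> - a)" for a
  let ?e = "\<lambda>a x. cis (2 * pi * a * x)"
  have e_mult: "?e a x * cnj (?e b x) = ?e (a - b) x" for a b x
    by (simp add: cis_cnj cis_mult algebra_simps)
  have int: "integrable M (?e a)" for a
  proof (rule integrable_const_bound[of _ 1])
    have "?e a \<in> borel_measurable borel"
      by (intro borel_measurable_continuous_onI continuous_intros)
    then show "?e a \<in> borel_measurable M" by simp
  qed simp
  have integrand: "complex_of_real ((cmod (?e \<xi> x - (\<Sum>a\<in>F. c a * ?e a x)))\<^sup>2) =
      1 - (\<Sum>a\<in>F. cnj (c a) * ?e (\<xi> - a) x) - (\<Sum>a\<in>F. c a * ?e (a - \<xi>) x) +
      (\<Sum>a\<in>F. \<Sum>b\<in>F. c a * cnj (c b) * ?e (a - b) x)" for x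
  proof -
    have "complex_of_real ((cmod (?e \<xi> x - (\<Sum>a\<in>F. c a * ?e a x)))\<^sup>2) =
        (?e \<xi> x - (\<Sum>a\<in>F. c a * ?e a x)) * (cnj (?e \<xi> x) - (\<Sum>a\<in>F. cnj (c a) * cnj (?e a x)))"
      unfolding complex_norm_square by simp
    also have "\<dots> = ?e \<xi> x * cnj (?e \<xi> x) - (\<Sum>a\<in>F. cnj (c a) * (?e \<xi> x * cnj (?e a x)))
        - (\<Sum>a\<in>F. c a * (?e a x * cnj (?e \<xi> x)))
        + (\<Sum>a\<in>F. \<Sum>b\<in>F. c a * cnj (c b) * (?e a x * cnj (?e b x)))"
      by (simp add: ring_distribs sum_product sum_distrib_left sum_distrib_right mult_ac) (rule sum.swap)
    finally show ?thesis
      unfolding e_mult by simp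
  qed
  have "complex_of_real (L2_dist_sq M (?e \<xi>) (\<lambda>x. \<Sum>a\<in>F. c a * ?e a x)) =
      (\<integral>x. 1 - (\<Sum>a\<in>F. cnj (c a) * ?e (\<xi> - a) x) - (\<Sum>a\<in>F. c a * ?e (a - \<xi>) x) +
        (\<Sum>a\<in>F. \<Sum>b\<in>F. c a * cnj (c b) * ?e (a - b) x) \<partial>M)"
    unfolding L2_dist_sq_def integral_complex_of_real[symmetric] by (simp only: integrand)
  also have "\<dots> = 1 - (\<Sum>a\<in>F. cnj (c a) * ft M (\<xi> - a)) - (\<Sum>a\<in>F. c a * ft M (a - \<xi>)) +
      (\<Sum>a\<in>F. \<Sum>b\<in>F. c a * cnj (c b) * ft M (a - b))"
    using int by (simp add: ft_eq_integral prob_space del: space_eq_univ)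
  also have "(\<Sum>a\<in>F. \<Sum>b\<in>F. c a * cnj (c b) * ft M (a - b)) = (\<Sum>a\<in>F. c a * cnj (c a))"
    using \<open>finite F\<close> by (simp add: orth if_distrib sum.delta cong: if_cong)
  also have "(\<Sum>a\<in>F. c a * ft M (a - \<xi>)) = (\<Sum>a\<in>F. c a * cnj (c a))"
    by (simp add: c_def flip: ft_uminus)
  also have "(\<Sum>a\<in>F. cnj (c a) * ft M (\<xi> - a)) = (\<Sum>a\<in>F. c a * cnj (c a))"
    by (simp add: c_def mult.commute)
  finally have "complex_of_real (L2_dist_sq M (?e \<xi>) (\<lambda>x. \<Sum>a\<in>F. c a * ?e a x)) =
      complex_of_real (1 - (\<Sum>a\<in>F. (cmod (c a))\<^sup>2))"
    by (simp add: complex_norm_square del: of_real_power)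
  then show ?thesis
    unfolding c_def of_real_eq_iff .
qed

text \<open>By the projection formula, \<open>complete\<close> places every exponential in the
  closure of \<open>trig \<Lambda>\<close>. All exponentials together span a dense subspace, and the
  closure is idempotent.\<close>

lemma is_spectrumI:
  assumes "real_distribution M" "AE x in M. x \<in> {0..1}" "countable \<Lambda>" "\<Lambda> \<noteq> {}"
    and orth: "\<And>a b. a \<in> \<Lambda> \<Longrightarrow> b \<in> \<Lambda> \<Longrightarrow> ft M (a - b) = (if a = b then 1 else 0)"
    and complete: "\<And>\<xi> e. e > 0 \<Longrightarrow> \<exists>F. finite F \<and> F \<subseteq> \<Lambda> \<and> 1 - e < (\<Sum>a\<in>F. (cmod (ft M (\<xi> + a)))\<^sup>2)"
  shows "is_spectrum M \<Lambda>"
proof -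
  have exp_eq: "exp (2 * complex_of_real pi * \<i> * of_real \<xi> * of_real x) = cis (2 * pi * \<xi> * x)" for \<xi> x
    by (simp add: cis_conv_exp mult_ac)
  have V: "trig \<Lambda> \<subseteq> L2_fun M"
    using trig_L2_fun[OF assms(1)] by blast
  have cis_closure: "(\<lambda>x. cis (2 * pi * \<xi> * x)) \<in> L2_closure M (trig \<Lambda>)" for \<xi>
    unfolding L2_closure_def
  proof (intro CollectI conjI allI impI)
    show "(\<lambda>x. cis (2 * pi * \<xi> * x)) \<in> L2_fun M"
      by (rule trig_L2_fun[OF assms(1) trig.cis[OF UNIV_I]])
    fix e :: real assume "e > 0"
    then obtain F where F: "finite F" "F \<subseteq> \<Lambda>" "1 - e < (\<Sum>a\<in>F. (cmod (ft M (- \<xi> + a)))\<^sup>2)"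
      using complete by blast
    \<comment> \<open>The hypothesis was used at \<open>- \<xi>\<close>; conjugation symmetry turns
      \<open>- \<xi> + a\<close> into the argument \<open>\<xi> - a\<close> of the projection
      formula.\<close>
    have "cmod (ft M (- \<xi> + a)) = cmod (ft M (\<xi> - a))" for a
      using ft_uminus[of M "\<xi> - a"] by simp
    moreover have "L2_dist_sq M (\<lambda>x. cis (2 * pi * \<xi> * x)) (\<lambda>x. \<Sum>a\<in>F. ft M (\<xi> - a) * cis (2 * pi * a * x)) =
        1 - (\<Sum>a\<in>F. (cmod (ft M (\<xi> - a)))\<^sup>2)"
      using orth F(2) by (intro L2_dist_sq_cis_projection assms F(1)) auto
    ultimately have "L2_dist_sq M (\<lambda>x. cis (2 * pi * \<xi> * x)) (\<lambda>x. \<Sum>a\<in>F. ft M (\<xi> - a) * cis (2 * pi * a * x)) < e"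
      using F(3) by simp
    then show "\<exists>g\<in>trig \<Lambda>. L2_dist_sq M (\<lambda>x. cis (2 * pi * \<xi> * x)) g < e"
      using trig_sum[OF F(1,2) \<open>\<Lambda> \<noteq> {}\<close>, where c = "\<lambda>a. ft M (\<xi> - a)"] by blast
  qed
  have "f \<in> L2_closure M (trig \<Lambda>)" if "f \<in> trig UNIV" for f
    using that by induction (auto intro: cis_closure L2_closure_add[OF V trig.add] L2_closure_scale[OF trig.scale])
  then have "L2_closure M (trig UNIV) \<subseteq> L2_closure M (trig \<Lambda>)"
    by (intro L2_closure_idem V) auto
  then have closure: "L2_fun M \<subseteq> L2_closure M (trig \<Lambda>)"
    by (simp only: L2_closure_trig_UNIV[OF assms(1,2)])
  show ?thesis
    unfolding is_spectrum_def orthonormal_basis_L2_def exp_eq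
  proof (intro conjI ballI allI impI)
    fix a assume "a \<in> \<Lambda>"
    then show "(\<lambda>x. cis (2 * pi * a * x)) \<in> L2_fun M"
      using V trig.cis by blast
  next
    fix a b assume ab: "a \<in> \<Lambda>" "b \<in> \<Lambda>"
    have "L2_inner M (\<lambda>x. cis (2 * pi * a * x)) (\<lambda>x. cis (2 * pi * b * x)) = ft M (a - b)"
      by (simp add: L2_inner_def ft_eq_integral cis_cnj cis_mult algebra_simps)
    then show "L2_inner M (\<lambda>x. cis (2 * pi * a * x)) (\<lambda>x. cis (2 * pi * b * x)) = (if a = b then 1 else 0)"
      using orth[OF ab] by simp
  next
    fix f and e :: real assume f: "f \<in> L2_fun M" and "e > 0"
    then have "f \<in> L2_closure M (trig \<Lambda>)" using closure by blast
    moreover have "e\<^sup>2 > 0" using \<open>e > 0\<close> by simp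
    ultimately obtain g where g: "g \<in> trig \<Lambda>" "L2_dist_sq M f g < e\<^sup>2"
      by (rule L2_closureE)
    have "L2_dist M f g = sqrt (L2_dist_sq M f g)"
      by (simp add: L2_dist_def L2_dist_sq_def)
    also have "\<dots> < e"
      using g(2) \<open>e > 0\<close> by (simp add: real_less_lsqrt real_sqrt_less_iff real_sqrt_lt_0_iff)
    finally show "\<exists>F c. finite F \<and> F \<subseteq> \<Lambda> \<and> L2_dist M f (\<lambda>x. \<Sum>i\<in>F. c i * cis (2 * pi * i * x)) < e"
      using trig_eq_sum[OF g(1)] by blast
  qed fact
qed

section \<open>Fourier transforms on integer translates\<close>

text \<open>The interval is compact and the circle is Hausdorff, so the winding map is a quotient
  map. Continuity of \<open>H\<close> can therefore be tested after composition with it.\<close>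

lemma continuous_on_circle_of_loop:
  fixes h :: "real \<Rightarrow> complex"
  assumes h: "continuous_on {0..1} h" and eq: "h 0 = h 1"
  obtains H where "continuous_on (sphere 0 1) H" "\<And>t. t \<in> {0..1} \<Longrightarrow> H (cis (2 * pi * t)) = h t"
proof -
  define H where "H z = h (Arg2pi z / (2 * pi))" for z
  have H: "H (cis (2 * pi * t)) = h t" if "t \<in> {0..1}" for t
  proof (cases "t = 1")
    case True
    then show ?thesis using eq Arg2pi_of_real[of 1] by (simp add: H_def)
  next
    case False
    then have "Arg2pi (cis (2 * pi * t)) = 2 * pi * t"
      using that by (intro Arg2pi_unique[of 1]) (auto simp: cis_conv_exp)
    then show ?thesis by (simp add: H_def)
  qed
  have "z \<in> (\<lambda>t. cis (2 * pi * t)) ` {0..1}" if "z \<in> sphere 0 1" for z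
  proof
    show "z = cis (2 * pi * (Arg2pi z / (2 * pi)))"
      using that Arg2pi_eq[of z] by (simp add: cis_conv_exp)
    show "Arg2pi z / (2 * pi) \<in> {0..1}"
      using Arg2pi_ge_0[of z] Arg2pi_lt_2pi[of z] by (simp add: less_imp_le)
  qed
  then have img: "(\<lambda>t. cis (2 * pi * t)) ` {0..1} = sphere 0 1"
    by (auto simp: image_iff)
  have "quotient_map (top_of_set {0..1}) (top_of_set (sphere 0 1)) (\<lambda>t. cis (2 * pi * t))"
    by (rule T1_Spaces.continuous_imp_quotient_map)
      (auto simp: continuous_map_in_subtopology compact_space_subtopology Hausdorff_space_subtopology img
         intro!: continuous_intros)
  moreover have "continuous_map (top_of_set {0..1}) euclidean (H \<circ> (\<lambda>t. cis (2 * pi * t)))"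
  proof -
    have "continuous_on {0..1} (H \<circ> (\<lambda>t. cis (2 * pi * t)))"
      using h by (rule continuous_on_eq) (simp add: H)
    then show ?thesis by simp
  qed
  ultimately have "continuous_map (top_of_set (sphere 0 1)) euclidean H"
    by (rule continuous_compose_quotient_map)
  then have "continuous_on (sphere 0 1) H" by simp
  then show ?thesis using H that by blast
qed

text \<open>The hypothesis says that the image of \<open>cis (2 * pi * x0 * x) dM\<close> on the circle has no nonzero
  Fourier coefficient. As \<open>{0<..<1}\<close> embeds into the circle, \<open>M\<close> lives on \<open>{0, 1}\<close>, and the two
  atoms cancel.\<close>

lemma char_eq_if_integer_translates_zero:
  assumes "real_distribution M" and supp: "AE x in M. x \<in> {0..1}"
    and zero: "\<And>k::int. ft M (x0 + of_int k) = 0"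
  shows "char M t = (1 + cis t) / 2"
proof -
  interpret real_distribution M by fact
  let ?g = "\<lambda>x. cis (2 * pi * x0 * x)"
  have [measurable]: "?g \<in> borel_measurable borel"
    by (intro borel_measurable_continuous_onI continuous_intros)
  have int: "integrable M f" if "f \<in> borel_measurable borel" "\<And>x. cmod (f x) \<le> C" for f :: "real \<Rightarrow> complex" and C
    using that by (intro integrable_const_bound[of _ C]) auto
  have trig_int: "integrable M (\<lambda>x. ?g x * f x)" if f: "f \<in> trig \<int>" for f
  proof -
    have [measurable]: "f \<in> borel_measurable borel"
      using trig_continuous[OF f] by (rule borel_measurable_continuous_onI)
    obtain C where "\<And>x. cmod (f x) \<le> C" using trig_bounded[OF f] by blast
    then show ?thesis by (intro int[of _ C]) (auto simp: norm_mult)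
  qed
  have trig_zero: "(\<integral>x. ?g x * f x \<partial>M) = 0" if "f \<in> trig \<int>" for f
    using that
  proof induction
    case (cis \<xi>)
    then obtain k where k: "\<xi> = of_int k" by (auto elim: Ints_cases)
    have "(\<integral>x. ?g x * cis (2 * pi * \<xi> * x) \<partial>M) = ft M (x0 + of_int k)"
      by (simp add: ft_eq_integral cis_mult k algebra_simps)
    then show ?case using zero by simp
  next
    case (add f h)
    have "(\<integral>x. ?g x * (f x + h x) \<partial>M) = (\<integral>x. ?g x * f x + ?g x * h x \<partial>M)"
      by (simp add: distrib_left)
    then show ?case
      using add trig_int by simp
  next
    case (scale f c)
    have "(\<integral>x. ?g x * (c * f x) \<partial>M) = (\<integral>x. c * (?g x * f x) \<partial>M)"
      by (simp add: mult.left_commute)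
    then show ?case
      using scale by simp
  qed
  \<comment> \<open>The sine vanishes at 0 and 1, so \<open>h\<close> closes up to a function on the
    circle. The phase cancels \<open>?g\<close>, which leaves the nonnegative integrand
    \<open>\<bar>sin (pi * x)\<bar>\<close> on [0, 1].\<close>
  define h where "h t = cis (- (2 * pi * x0 * t)) * complex_of_real (sin (pi * t))" for t
  have "continuous_on {0..1} h"
    unfolding h_def by (intro continuous_intros)
  then obtain H where H: "continuous_on (sphere 0 1) H" "\<And>t. t \<in> {0..1} \<Longrightarrow> H (cis (2 * pi * t)) = h t"
    using continuous_on_circle_of_loop[of h] by (auto simp: h_def)
  have cont: "continuous_on UNIV (\<lambda>t. H (cis (2 * pi * t)))"
    by (rule continuous_on_compose2[OF H(1)]) (auto intro!: continuous_intros)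
  then have [measurable]: "(\<lambda>t. H (cis (2 * pi * t))) \<in> borel_measurable borel"
    by (rule borel_measurable_continuous_onI)
  \<comment> \<open>On the circle, \<open>H\<close> is uniformly within \<open>e\<close> of an
    integer trigonometric polynomial, whose integral against \<open>?g\<close> is 0.\<close>
  have small: "cmod (\<integral>x. ?g x * H (cis (2 * pi * x)) \<partial>M) \<le> 0 + e" if "e > 0" for e
  proof -
    obtain f where f: "f \<in> trig \<int>" "\<And>t. cmod (H (cis (2 * pi * t)) - f t) < e"
      using trig_dense_circle[OF H(1) \<open>e > 0\<close>] by blast
    have [measurable]: "f \<in> borel_measurable borel"
      using trig_continuous[OF f(1)] by (rule borel_measurable_continuous_onI)
    have int': "integrable M (\<lambda>x. ?g x * (H (cis (2 * pi * x)) - f x))"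
      using f(2) by (intro int[of _ e]) (auto simp: norm_mult less_imp_le)
    have "(\<integral>x. ?g x * H (cis (2 * pi * x)) \<partial>M) =
        (\<integral>x. ?g x * (H (cis (2 * pi * x)) - f x) + ?g x * f x \<partial>M)"
      by (simp add: algebra_simps)
    also have "\<dots> = (\<integral>x. ?g x * (H (cis (2 * pi * x)) - f x) \<partial>M)"
      using int' trig_int[OF f(1)] trig_zero[OF f(1)] by simp
    also have "cmod \<dots> \<le> (\<integral>x. cmod (?g x * (H (cis (2 * pi * x)) - f x)) \<partial>M)"
      by (rule integral_norm_bound)
    also have "\<dots> \<le> (\<integral>x. e \<partial>M)"
      by (rule integral_mono[OF integrable_norm[OF int']]) (auto simp: norm_mult f(2) less_imp_le)
    finally show ?thesis by (simp add: prob_space del: space_eq_univ)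
  qed
  have "(\<integral>x. ?g x * H (cis (2 * pi * x)) \<partial>M) = 0"
    using field_le_epsilon[OF small] by (simp only: norm_le_zero_iff)
  also have "(\<integral>x. ?g x * H (cis (2 * pi * x)) \<partial>M) = (\<integral>x. complex_of_real \<bar>sin (pi * x)\<bar> \<partial>M)"
  proof (rule integral_cong_AE)
    show "AE x in M. ?g x * H (cis (2 * pi * x)) = complex_of_real \<bar>sin (pi * x)\<bar>"
      using supp
    proof eventually_elim
      case (elim x)
      then have "sin (pi * x) \<ge> 0"
        by (intro sin_ge_zero) auto
      then show ?case
        using elim by (simp add: H h_def cis_mult flip: mult.assoc)
    qed
  qed measurable
  finally have "(\<integral>x. \<bar>sin (pi * x)\<bar> \<partial>M) = 0"
    by simp
  moreover have "integrable M (\<lambda>x. \<bar>sin (pi * x)\<bar>)"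
    by (rule integrable_const_bound[of _ 1]) auto
  ultimately have "AE x in M. \<bar>sin (pi * x)\<bar> = 0"
    by (subst (asm) integral_nonneg_eq_0_iff_AE) auto
  with supp have atoms: "AE x in M. x = 0 \<or> x = 1"
  proof eventually_elim
    case (elim x)
    show ?case
    proof (rule ccontr)
      assume "\<not> (x = 0 \<or> x = 1)"
      then have "sin (pi * x) > 0"
        using elim(1) by (intro sin_gt_zero) (auto simp: less_le)
      then show False using elim(2) by simp
    qed
  qed
  \<comment> \<open>As \<open>M\<close> lives on {0, 1}, its mean \<open>q\<close> is the mass of
    the atom 1, and on these two points \<open>cis (s * x)\<close> agrees with an affine function of
    \<open>x\<close>.\<close>
  define q where "q = (\<integral>x. x \<partial>M)"
  have int_id: "integrable M (\<lambda>x. x)"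
    by (rule integrable_const_bound[of _ 1]) (use supp in \<open>auto elim: eventually_mono\<close>)
  have char: "char M s = 1 + (cis s - 1) * complex_of_real q" for s
  proof -
    have "char M s = (\<integral>x. 1 + (cis s - 1) * complex_of_real x \<partial>M)"
      unfolding char_def
    proof (rule integral_cong_AE)
      show "AE x in M. exp (\<i> * complex_of_real (s * x)) = 1 + (cis s - 1) * complex_of_real x"
        using atoms by eventually_elim (auto simp: cis_conv_exp)
    qed measurable
    also have "\<dots> = 1 + (cis s - 1) * complex_of_real q"
      using int_id by (simp add: q_def prob_space del: space_eq_univ)
    finally show ?thesis .
  qed
  \<comment> \<open>The vanishing at \<open>x0\<close> itself forces the two atoms to have equal
    modulus after rotation, that is, equal mass.\<close>
  have "complex_of_real (1 - q) = - (cis (2 * pi * x0) * complex_of_real q)"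
    using zero[of 0] by (simp add: ft_def char algebra_simps add_eq_0_iff2 eq_neg_iff_add_eq_0)
  then have "cmod (complex_of_real (1 - q)) = cmod (cis (2 * pi * x0) * complex_of_real q)"
    by (simp only: norm_minus_cancel)
  then have "\<bar>1 - q\<bar> = \<bar>q\<bar>"
    by (simp only: norm_mult norm_of_real norm_cis mult_1)
  then have "q = 1 / 2" by arith
  show ?thesis
    by (simp add: char \<open>q = 1 / 2\<close> add_divide_distrib diff_divide_distrib)
qed

lemma char_unif_dirac_0_1: "char (unif_dirac {0, 1}) t = (1 + cis t) / 2"
  by (subst char_unif_dirac) simp_all

text \<open>A subsequence limit different from the two-point measure has a nonzero value on every
  coset of the integers. Convergence and the common Lipschitz constant spread each such value to a
  neighbourhood, and finitely many neighbourhoods cover a period.\<close>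

lemma equi_positive_subsequence:
  assumes M: "\<And>n. real_distribution (M n)" and supp: "\<And>n. AE x in M n. x \<in> {0..1}"
    and nconv: "\<not> weak_conv_m M (unif_dirac {0, 1})"
  obtains S \<epsilon> \<delta> where "infinite S" "\<epsilon> > 0" "\<delta> > 0"
    "\<And>n x. n \<in> S \<Longrightarrow> \<exists>k::int. \<forall>y. \<bar>y\<bar> < \<delta> \<longrightarrow> \<epsilon> \<le> cmod (ft (M n) (x + of_int k + y))"
proof -
  define d where "d n t = dist (char (M n) t) (char (unif_dirac {0, 1}) t)" for n t
  obtain t where "\<not> (\<lambda>n. char (M n) t) \<longlonglongrightarrow> char (unif_dirac {0, 1}) t"
    using levy_continuity[of M "unif_dirac {0, 1}"] M real_distribution_unif_dirac nconv by blast
  then have "\<not> (\<forall>e>0. \<exists>n0. \<forall>n\<ge>n0. d n t < e)"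
    by (simp add: lim_sequentially d_def)
  then obtain e where e: "e > 0" "\<forall>n0. \<exists>n\<ge>n0. \<not> d n t < e"
    by (simp only: not_all not_ex not_imp) iprover
  from e(2) have "infinite {n. \<not> d n t < e}"
    by (simp add: infinite_nat_iff_unbounded_le)
  then obtain s :: "nat \<Rightarrow> nat" where s: "strict_mono s" "\<And>n. \<not> d (s n) t < e"
    using infinite_enumerate[of "{n. \<not> d n t < e}"] by auto
  have "tight M"
    using M supp by (rule tight_atLeastAtMost)
  from tight_imp_convergent_subsubsequence[OF this s(1)]
  obtain r :: "nat \<Rightarrow> nat" and M' where r: "strict_mono r" and M': "real_distribution M'" and weak: "weak_conv_m (M \<circ> s \<circ> r) M'"
    by blast
  define u where "u n = s (r n)" for n
  have weak: "weak_conv_m (\<lambda>n. M (u n)) M'"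
    using weak by (simp add: comp_def u_def)
  have "strict_mono u"
    using strict_mono_o[OF s(1) r] by (simp add: comp_def u_def[abs_def])
  note char_lim = levy_continuity1[OF M M' weak]
  have supp': "AE x in M'. x \<in> {0..1}"
    using M M' weak supp by (rule AE_weak_limit_atLeastAtMost)
  \<comment> \<open>The gap \<open>e\<close> at the point \<open>t\<close> survives the passage to
    the limit along the subsequence.\<close>
  have "e \<le> dist (char M' t) (char (unif_dirac {0, 1}) t)"
  proof (rule LIMSEQ_le_const)
    show "(\<lambda>n. dist (char (M (u n)) t) (char (unif_dirac {0, 1}) t)) \<longlonglongrightarrow> dist (char M' t) (char (unif_dirac {0, 1}) t)"
      by (intro tendsto_intros char_lim)
  qed (use s(2) in \<open>simp add: u_def d_def not_less\<close>)
  then have "0 < dist (char M' t) (char (unif_dirac {0, 1}) t)"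
    using \<open>e > 0\<close> by linarith
  then have neq: "char M' t \<noteq> (1 + cis t) / 2"
    by (simp only: char_unif_dirac_0_1 zero_less_dist_iff) simp
  have "\<exists>k::int. ft M' (x + of_int k) \<noteq> 0" for x
  proof (rule ccontr)
    assume "\<nexists>k::int. ft M' (x + of_int k) \<noteq> 0"
    then have "ft M' (x + of_int k) = 0" for k :: int
      by simp
    from char_eq_if_integer_translates_zero[OF M' supp' this] neq show False
      by simp
  qed
  then obtain k :: "real \<Rightarrow> int" where k: "\<And>x. ft M' (x + of_int (k x)) \<noteq> 0"
    by metis
  \<comment> \<open>The modulus is cut into four quarters: one is given up to convergence, leaving
    \<open>3 * c x\<close>, and two to moving \<open>z\<close> and \<open>y\<close> by less than
    \<open>c x / (2 * pi)\<close> each. One quarter remains as the lower bound.\<close>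
  define c where "c x = cmod (ft M' (x + of_int (k x))) / 4" for x
  have c: "c x > 0" for x
    using k by (simp add: c_def)
  have near: "eventually (\<lambda>n. \<forall>z y. \<bar>z - x\<bar> < c x / (2 * pi) \<longrightarrow> \<bar>y\<bar> < c x / (2 * pi) \<longrightarrow>
      c x \<le> cmod (ft (M (u n)) (z + of_int (k x) + y))) sequentially" for x
  proof -
    have "(\<lambda>n. cmod (ft (M (u n)) (x + of_int (k x)))) \<longlonglongrightarrow> cmod (ft M' (x + of_int (k x)))"
      unfolding ft_def by (intro tendsto_intros char_lim)
    moreover have "3 * c x < cmod (ft M' (x + of_int (k x)))"
      using c[of x] by (simp add: c_def)
    ultimately have "eventually (\<lambda>n. 3 * c x < cmod (ft (M (u n)) (x + of_int (k x)))) sequentially"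
      by (rule order_tendstoD(1))
    then show ?thesis
    proof (eventually_elim, intro allI impI)
      fix n z y
      assume *: "3 * c x < cmod (ft (M (u n)) (x + of_int (k x)))" "\<bar>z - x\<bar> < c x / (2 * pi)" "\<bar>y\<bar> < c x / (2 * pi)"
      have "cmod (ft (M (u n)) (x + of_int (k x)) - ft (M (u n)) (z + of_int (k x) + y)) \<le> 2 * pi * \<bar>x - z - y\<bar>"
        using norm_ft_diff_le[OF M supp, of "u n" "x + of_int (k x)" "z + of_int (k x) + y"] by (simp add: algebra_simps)
      also have "\<dots> \<le> 2 * pi * (c x / (2 * pi) + c x / (2 * pi))"
        using * by (intro mult_left_mono) auto
      also have "\<dots> = 2 * c x" by simp
      finally show "c x \<le> cmod (ft (M (u n)) (z + of_int (k x) + y))"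
        using *(1) norm_triangle_sub[of "ft (M (u n)) (x + of_int (k x))" "ft (M (u n)) (z + of_int (k x) + y)"] by linarith
    qed
  qed
  have "{0..1::real} \<subseteq> (\<Union>x\<in>{0..1}. ball x (c x / (2 * pi)))"
  proof
    fix x :: real assume "x \<in> {0..1}"
    then show "x \<in> (\<Union>x\<in>{0..1}. ball x (c x / (2 * pi)))"
      using c[of x] by (intro UN_I[of x]) simp_all
  qed
  then obtain X where X: "X \<subseteq> {0..1}" "finite X" "{0..1::real} \<subseteq> (\<Union>x\<in>X. ball x (c x / (2 * pi)))"
    by (rule compactE_image[OF compact_Icc open_ball])
  then have "X \<noteq> {}" by auto
  define \<epsilon> where "\<epsilon> = Min (c ` X)"
  have \<epsilon>: "\<epsilon> > 0" "\<And>x. x \<in> X \<Longrightarrow> \<epsilon> \<le> c x"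
    using X(2) \<open>X \<noteq> {}\<close> c by (auto simp: \<epsilon>_def)
  have "eventually (\<lambda>n. \<forall>x\<in>X. \<forall>z y. \<bar>z - x\<bar> < c x / (2 * pi) \<longrightarrow> \<bar>y\<bar> < c x / (2 * pi) \<longrightarrow>
      c x \<le> cmod (ft (M (u n)) (z + of_int (k x) + y))) sequentially"
    using X(2) near by (simp add: eventually_ball_finite)
  then obtain n0 where n0: "\<And>n x z y. n \<ge> n0 \<Longrightarrow> x \<in> X \<Longrightarrow> \<bar>z - x\<bar> < c x / (2 * pi) \<Longrightarrow> \<bar>y\<bar> < c x / (2 * pi) \<Longrightarrow>
      c x \<le> cmod (ft (M (u n)) (z + of_int (k x) + y))"
    unfolding eventually_sequentially by blast
  show ?thesis
  proof (rule that[of "u ` {n0..}" \<epsilon> "\<epsilon> / (2 * pi)"])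
    show "infinite (u ` {n0..})"
      using \<open>strict_mono u\<close> by (simp add: finite_image_iff strict_mono_imp_inj_on infinite_Ici)
    show "\<epsilon> > 0" "\<epsilon> / (2 * pi) > 0"
      using \<epsilon>(1) by simp_all
    fix n and x :: real assume "n \<in> u ` {n0..}"
    then obtain m where m: "n = u m" "m \<ge> n0" by auto
    \<comment> \<open>The cover only concerns [0, 1], so \<open>x\<close> is replaced by its
      fractional part and the integer is corrected by \<open>\<lfloor>x\<rfloor>\<close>.\<close>
    define z where "z = x - of_int \<lfloor>x\<rfloor>"
    have "z \<in> {0..1}"
      unfolding z_def atLeastAtMost_iff by linarith
    then obtain a where a: "a \<in> X" "\<bar>z - a\<bar> < c a / (2 * pi)"
      using X(3) by (auto simp: dist_real_def abs_minus_commute)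
    show "\<exists>k::int. \<forall>y. \<bar>y\<bar> < \<epsilon> / (2 * pi) \<longrightarrow> \<epsilon> \<le> cmod (ft (M n) (x + of_int k + y))"
    proof (intro exI[of _ "k a - \<lfloor>x\<rfloor>"] allI impI)
      fix y :: real assume "\<bar>y\<bar> < \<epsilon> / (2 * pi)"
      then have "\<bar>y\<bar> < c a / (2 * pi)"
        using \<epsilon>(2)[OF a(1)] by (smt (verit) divide_right_mono pi_gt_zero)
      from n0[OF m(2) a this] show "\<epsilon> \<le> cmod (ft (M n) (x + of_int (k a - \<lfloor>x\<rfloor>) + y))"
        using \<epsilon>(2)[OF a(1)] by (simp add: m z_def algebra_simps)
    qed
  qed
qed

section \<open>Cantor-Moran measures\<close>

locale moran =
  fixes N :: "nat \<Rightarrow> int" and B :: "nat \<Rightarrow> int set"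
  assumes N_ge_2: "n \<ge> 1 \<Longrightarrow> N n \<ge> 2"
    and B_nonempty: "n \<ge> 1 \<Longrightarrow> B n \<noteq> {}"
    and B_subset: "n \<ge> 1 \<Longrightarrow> B n \<subseteq> {0..N n - 1}"
begin

lemma finite_B: "n \<ge> 1 \<Longrightarrow> finite (B n)"
  using B_subset finite_subset by blast

lemma scale_Suc: "scale N (Suc n) = scale N n * of_int (N (Suc n))"
  by (simp add: scale_def)

lemma scale_ge: "scale N n \<ge> 2 ^ n"
proof (induction n)
  case (Suc n)
  then show ?case
    using mult_mono[of "2 ^ n" "scale N n" 2 "of_int (N (Suc n))"] N_ge_2[of "Suc n"]
    by (simp add: scale_Suc mult.commute order_trans[OF zero_le_power Suc.IH])
qed (simp add: scale_def)

lemma scale_pos: "scale N n > 0"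
  by (rule less_le_trans[OF _ scale_ge]) simp

text \<open>This is the transform of the uniform distribution on the unscaled digit set, a function
  of period 1.\<close>

definition mask :: "nat \<Rightarrow> real \<Rightarrow> complex" where
  "mask n \<xi> = (\<Sum>b\<in>B n. cis (2 * pi * \<xi> * of_int b)) / of_nat (card (B n))"

text \<open>This is the transform of \<open>\<mu>\<^sub>n\<close>; the shift to \<open>Suc i\<close>
  reflects that the digit sets are indexed from 1.\<close>

definition mask_prod :: "nat \<Rightarrow> real \<Rightarrow> complex" where
  "mask_prod n \<xi> = (\<Prod>i<n. mask (Suc i) (\<xi> / scale N (Suc i)))"

lemma ft_moran_factor:
  assumes "n \<ge> 1"
  shows "ft (moran_factor N B n) \<xi> = mask n (\<xi> / scale N n)"
proof -
  have inj: "inj_on (\<lambda>b. 1 / scale N n * real_of_int b) (B n)"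
    using scale_pos[of n] by (auto simp: inj_on_def)
  show ?thesis
    using assms finite_B[OF assms] B_nonempty[OF assms]
    by (simp add: ft_def moran_factor_def char_unif_dirac sum.reindex[OF inj] card_image[OF inj] mask_def
        del: times_divide_eq_left) (simp add: mult.assoc)
qed

lemma AE_moran_factor:
  assumes "n \<ge> 1"
  shows "AE x in moran_factor N B n. x \<in> {0..(of_int (N n) - 1) / scale N n}"
proof -
  have "AE x in moran_factor N B n. x \<in> (\<lambda>b. (1 / scale N n) * real_of_int b) ` B n"
    unfolding moran_factor_def using finite_B[OF assms] B_nonempty[OF assms]
    by (intro AE_unif_dirac) auto
  then show ?thesis
  proof eventually_elim
    case (elim x)
    then obtain b where b: "b \<in> B n" "x = (1 / scale N n) * real_of_int b" by auto
    then have "0 \<le> b" "b \<le> N n - 1"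
      using B_subset[OF assms] by auto
    then have "0 \<le> real_of_int b" "real_of_int b \<le> real_of_int (N n) - 1"
      by linarith+
    then show ?case
      using b(2) scale_pos[of n] by (auto simp: divide_right_mono)
  qed
qed

text \<open>The largest possible digits give supports whose lengths \<open>(N - 1) / scale\<close>
  telescope to at most \<open>1 / scale N n\<close>. This is what places \<open>nu_tail\<close> on
  [0, 1].\<close>

lemma mu_tail:
  shows real_distribution_mu_tail: "real_distribution (mu_tail N B n)"
    and AE_mu_tail: "AE x in mu_tail N B n. x \<in> {0..1 / scale N n}"
    and ft_mu_tail_lim: "(\<lambda>m. \<Prod>i<m. mask (n + i + 1) (\<xi> / scale N (n + i + 1))) \<longlonglongrightarrow> ft (mu_tail N B n) \<xi>"
proof -
  let ?X = "\<lambda>k. moran_factor N B (n + k + 1)"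
  let ?a = "\<lambda>k. (real_of_int (N (n + k + 1)) - 1) / scale N (n + k + 1)"
  have X: "real_distribution (?X k)" for k
    unfolding moran_factor_def by (rule real_distribution_unif_dirac)
  have supp: "AE x in ?X k. x \<in> {0..?a k}" for k
    by (rule AE_moran_factor) simp
  have "?a k = 1 / scale N (n + k) - 1 / scale N (n + k + 1)" for k
    using scale_pos[of "n + k"] N_ge_2[of "Suc (n + k)"]
    by (simp add: scale_Suc divide_simps)
  then have "(\<Sum>k<m. ?a k) = 1 / scale N n - 1 / scale N (n + m)" for m
    by (induction m) auto
  then have bound: "(\<Sum>k<m. ?a k) \<le> 1 / scale N n" for m
    using scale_pos[of "n + m"] by (simp add: less_imp_le)
  note conv = inf_conv_bounded[OF X supp bound]
  show "real_distribution (mu_tail N B n)" "AE x in mu_tail N B n. x \<in> {0..1 / scale N n}"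
    unfolding mu_tail_def by (rule conv(1), rule conv(2))
  show "(\<lambda>m. \<Prod>i<m. mask (n + i + 1) (\<xi> / scale N (n + i + 1))) \<longlonglongrightarrow> ft (mu_tail N B n) \<xi>"
    using conv(3)[of "2 * pi * \<xi>"] by (simp add: mu_tail_def ft_moran_factor[unfolded ft_def] ft_def)
qed

lemma cantor_moran_eq: "cantor_moran N B = mu_tail N B 0"
  by (simp add: cantor_moran_def mu_tail_def)

lemma real_distribution_nu_tail: "real_distribution (nu_tail N B n)"
  unfolding nu_tail_def
  by (intro prob_space.real_distribution_distr real_distribution.axioms(1)[OF real_distribution_mu_tail])
    (simp add: measurable_cong_sets[OF real_distribution.events_eq_borel[OF real_distribution_mu_tail] refl])

lemma AE_nu_tail: "AE x in nu_tail N B n. x \<in> {0..1}"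
proof -
  interpret real_distribution "mu_tail N B n" by (rule real_distribution_mu_tail)
  show ?thesis
    unfolding nu_tail_def
    by (subst AE_distr_iff, simp, simp, use AE_mu_tail[of n] in eventually_elim)
      (use scale_pos[of n] in \<open>auto simp: field_simps\<close>)
qed

lemma ft_nu_tail: "ft (nu_tail N B n) \<xi> = ft (mu_tail N B n) (scale N n * \<xi>)"
proof -
  interpret real_distribution "mu_tail N B n" by (rule real_distribution_mu_tail)
  show ?thesis
    unfolding nu_tail_def ft_def char_def by (subst integral_distr) (auto simp: mult_ac)
qed

lemma mask_prod_tendsto: "(\<lambda>n. mask_prod n \<xi>) \<longlonglongrightarrow> ft (cantor_moran N B) \<xi>"
  using ft_mu_tail_lim[of 0 \<xi>] by (simp add: cantor_moran_eq mask_prod_def)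

text \<open>Both sides are the limit of \<open>mask_prod (n + m) \<xi>\<close> as \<open>m\<close>
  grows, the first \<open>n\<close> factors being fixed.\<close>

lemma ft_cantor_moran:
  "ft (cantor_moran N B) \<xi> = mask_prod n \<xi> * ft (nu_tail N B n) (\<xi> / scale N n)"
proof -
  have eq: "mask_prod (n + m) \<xi> =
      mask_prod n \<xi> * (\<Prod>i<m. mask (n + i + 1) (\<xi> / scale N (n + i + 1)))" for m
    by (induction m) (simp_all add: mask_prod_def)
  have "(\<lambda>m. mask_prod (n + m) \<xi>) \<longlonglongrightarrow> ft (cantor_moran N B) \<xi>"
    using LIMSEQ_ignore_initial_segment[OF mask_prod_tendsto, of n \<xi>] by (simp add: add.commute)
  moreover have "(\<lambda>m. mask_prod (n + m) \<xi>) \<longlonglongrightarrow> mask_prod n \<xi> * ft (mu_tail N B n) \<xi>"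
    unfolding eq by (intro tendsto_intros ft_mu_tail_lim)
  ultimately show ?thesis
    using scale_pos[of n] by (simp add: ft_nu_tail LIMSEQ_unique)
qed

end

section \<open>Finite spectra\<close>

locale hadamard_moran = moran N B for N :: "nat \<Rightarrow> int" and B :: "nat \<Rightarrow> int set" +
  fixes L :: "nat \<Rightarrow> int set"
  assumes triple: "n \<ge> 1 \<Longrightarrow> hadamard_triple (N n) (B n) (L n)"
begin

text \<open>Up to the factor \<open>1 / sqrt m\<close>, the values of the mask are the entries of
  the adjoint Hadamard matrix applied to the vector \<open>u\<close> of \<open>m\<close> unimodular
  entries. Unitarity preserves the squared norm \<open>m\<close> of \<open>u\<close>.\<close>

lemma mask_sum:
  assumes n: "n \<ge> 1"
  shows "(\<Sum>l\<in>L n. (cmod (mask n (\<xi> + of_int l / of_int (N n))))\<^sup>2) = 1"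
proof -
  let ?H = "hadamard_matrix (N n) (B n)"
  define m where "m = card (B n)"
  have "m > 0"
    using finite_B[OF n] B_nonempty[OF n] by (simp add: m_def card_gt_0_iff)
  have unitary: "(\<Sum>l\<in>L n. ?H b l * cnj (?H b' l)) = (if b = b' then 1 else 0)" if "b \<in> B n" "b' \<in> B n" for b b'
    using triple[OF n] that by (auto simp: hadamard_triple_def unitary_matrix_on_def)
  define u where "u b = cis (2 * pi * \<xi> * of_int b)" for b
  have H: "cnj (?H b l) = cis (2 * pi * (of_int l / of_int (N n)) * of_int b) / complex_of_real (sqrt m)" for b l
  proof -
    have "?H b l = cis (- (2 * pi * (of_int l / of_int (N n)) * of_int b)) / complex_of_real (sqrt m)"
      by (simp add: hadamard_matrix_def m_def cis_conv_exp mult_ac)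
    then show ?thesis by (simp add: cis_cnj)
  qed
  have sqrt_m: "complex_of_real (sqrt m) * complex_of_real (sqrt m) = of_nat m"
    by (simp flip: of_real_mult)
  have mask: "mask n (\<xi> + of_int l / of_int (N n)) = (\<Sum>b\<in>B n. u b * cnj (?H b l)) / complex_of_real (sqrt m)" for l
    unfolding mask_def u_def H
    by (simp add: cis_mult algebra_simps m_def sqrt_m[unfolded m_def] flip: sum_divide_distrib)
  have "complex_of_real (\<Sum>l\<in>L n. (cmod (mask n (\<xi> + of_int l / of_int (N n))))\<^sup>2) =
      (\<Sum>l\<in>L n. (\<Sum>b\<in>B n. u b * cnj (?H b l)) * (\<Sum>b\<in>B n. cnj (u b) * ?H b l) / of_nat m)"
    by (simp only: of_real_sum complex_norm_square mask) (simp add: sqrt_m)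
  also have "\<dots> = (\<Sum>l\<in>L n. \<Sum>b\<in>B n. \<Sum>b'\<in>B n. u b * cnj (u b') * (?H b' l * cnj (?H b l))) / of_nat m"
    by (simp add: sum_product sum_divide_distrib mult_ac)
  also have "(\<Sum>l\<in>L n. \<Sum>b\<in>B n. \<Sum>b'\<in>B n. u b * cnj (u b') * (?H b' l * cnj (?H b l))) =
      (\<Sum>b\<in>B n. \<Sum>b'\<in>B n. u b * cnj (u b') * (\<Sum>l\<in>L n. ?H b' l * cnj (?H b l)))"
    unfolding sum_distrib_left 
    by (rule trans[OF sum.swap], rule sum.cong[OF refl], rule sum.swap)
  also have "\<dots> = (\<Sum>b\<in>B n. \<Sum>b'\<in>B n. if b' = b then 1 else 0)"
    by (intro sum.cong refl) (auto simp: unitary u_def cis_cnj cis_mult)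
  also have "\<dots> = of_nat m"
    using finite_B[OF n] by (simp add: m_def)
  finally have "complex_of_real (\<Sum>l\<in>L n. (cmod (mask n (\<xi> + of_int l / of_int (N n))))\<^sup>2) = 1"
    using \<open>m > 0\<close> by simp
  then show ?thesis
    by (simp only: of_real_eq_1_iff)
qed

definition int_scale :: "nat \<Rightarrow> int" where
  "int_scale n = (\<Prod>i=1..n. N i)"

lemma of_int_int_scale: "real_of_int (int_scale n) = scale N n"
  by (simp add: int_scale_def scale_def)

lemma mask_periodic: "mask n (\<xi> + of_int k) = mask n \<xi>"
proof -
  have "cis (2 * pi * (\<xi> + of_int k) * of_int b) = cis (2 * pi * \<xi> * of_int b)" for b
  proof -
    have "cis (2 * pi * (\<xi> + of_int k) * of_int b) = cis (2 * pi * \<xi> * of_int b) * cis (2 * pi * of_int (k * b))"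
      by (simp add: cis_mult algebra_simps)
    then show ?thesis
      by (simp add: cis_multiple_2pi del: of_int_mult)
  qed
  then show ?thesis by (simp add: mask_def)
qed

lemma mask_prod_Suc: "mask_prod (Suc n) \<xi> = mask_prod n \<xi> * mask (Suc n) (\<xi> / scale N (Suc n))"
  by (simp add: mask_prod_def)

lemma mask_prod_0: "mask_prod n 0 = 1"
proof -
  have "mask i 0 = 1" if "i \<ge> 1" for i
    using finite_B[OF that] B_nonempty[OF that] by (simp add: mask_def)
  then show ?thesis by (simp add: mask_prod_def)
qed

lemma mask_prod_periodic: "mask_prod n (\<xi> + scale N n * of_int k) = mask_prod n \<xi>"
\<comment> \<open>The integer \<open>k\<close> varies because one period at level
  \<open>Suc n\<close> consists of \<open>N (Suc n)\<close> periods at level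
  \<open>n\<close>.\<close>
proof (induction n arbitrary: k)
  case (Suc n)
  have "(\<xi> + scale N (Suc n) * of_int k) / scale N (Suc n) = \<xi> / scale N (Suc n) + of_int k"
    using scale_pos[of "Suc n"] by (simp add: add_divide_distrib)
  moreover have "mask_prod n (\<xi> + scale N (Suc n) * of_int k) = mask_prod n \<xi>"
    using Suc.IH[of "N (Suc n) * k"] by (simp add: scale_Suc mult.assoc)
  ultimately show ?case
    by (simp add: mask_prod_Suc mask_periodic)
qed (simp add: mask_prod_def)

text \<open>Parseval's identity for all exponentials expresses that \<open>\<Lambda>\<close> is a
  spectrum of \<open>\<mu>\<^sub>n\<close>; orthogonality is derived from it in
  \<open>eq_if_indexed_sum_1\<close>.\<close>

definition finite_spectrum :: "nat \<Rightarrow> int set \<Rightarrow> bool" where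
  "finite_spectrum n \<Lambda> \<longleftrightarrow> finite \<Lambda> \<and> (\<forall>\<xi>. (\<Sum>a\<in>\<Lambda>. (cmod (mask_prod n (\<xi> + of_int a)))\<^sup>2) = 1)"

lemma finite_spectrum_0: "finite_spectrum 0 {0}"
  by (simp add: finite_spectrum_def mask_prod_def)

text \<open>At \<open>\<xi> = - f j\<close> the term of index \<open>j\<close> is already 1, so
  every other term must vanish.\<close>

lemma eq_if_indexed_sum_1:
  fixes f :: "'i \<Rightarrow> real"
  assumes "finite I" and sum: "\<And>\<xi>. (\<Sum>i\<in>I. (cmod (mask_prod n (\<xi> + f i)))\<^sup>2) = 1"
    and ij: "i \<in> I" "j \<in> I" "mask_prod n (f i - f j) \<noteq> 0"
  shows "i = j"
proof (rule ccontr)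
  assume "i \<noteq> j"
  have "1 = (\<Sum>k\<in>I. (cmod (mask_prod n (- f j + f k)))\<^sup>2)"
    by (rule sum[symmetric])
  also have "\<dots> \<ge> (\<Sum>k\<in>{i, j}. (cmod (mask_prod n (- f j + f k)))\<^sup>2)"
    using assms by (intro sum_mono2) auto
  finally have "(cmod (mask_prod n (f i - f j)))\<^sup>2 \<le> 0"
    using \<open>i \<noteq> j\<close> by (simp add: mask_prod_0)
  then show False using ij(3) by simp
qed

text \<open>Injectivity comes for free: a repeated frequency \<open>f i\<close> would make the sum at \<open>\<xi> = - f i\<close> at least 2.\<close>

lemma finite_spectrum_image:
  fixes f :: "'i \<Rightarrow> int"
  assumes "finite I" and sum: "\<And>\<xi>. (\<Sum>i\<in>I. (cmod (mask_prod n (\<xi> + of_int (f i))))\<^sup>2) = 1"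
  shows "finite_spectrum n (f ` I)"
proof -
  have "inj_on f I"
    using eq_if_indexed_sum_1[OF assms] by (auto simp: inj_on_def mask_prod_0)
  then show ?thesis
    using assms by (simp add: finite_spectrum_def sum.reindex)
qed

text \<open>Shifts by multiples of \<open>scale N n\<close> are invisible to
  \<open>mask_prod n\<close>, so the sum over pairs splits: the inner sum over
  \<open>L (Suc n)\<close> is 1 by \<open>mask_sum\<close>, and the outer one is 1 by
  assumption.\<close>

lemma finite_spectrum_Suc:
  assumes "finite_spectrum n \<Lambda>"
  shows "\<exists>\<Lambda>'. \<Lambda> \<subseteq> \<Lambda>' \<and> finite_spectrum (Suc n) \<Lambda>'"
proof -
  have L: "finite (L (Suc n))" "L (Suc n) \<noteq> {}"
    using triple[of "Suc n"] by (auto simp: hadamard_triple_def)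
  then obtain l0 where l0: "l0 \<in> L (Suc n)" by blast
  \<comment> \<open>Subtracting \<open>l0\<close> makes the shift 0 for \<open>l = l0\<close>, which
    keeps \<open>\<Lambda>\<close> inside the new set.\<close>
  define f where "f = (\<lambda>(a, l). a + int_scale n * (l - l0))"
  have "(\<Sum>i\<in>\<Lambda> \<times> L (Suc n). (cmod (mask_prod (Suc n) (\<xi> + of_int (f i))))\<^sup>2) = 1" for \<xi>
  proof -
    have "mask_prod (Suc n) (\<xi> + of_int (f (a, l))) = mask_prod n (\<xi> + of_int a) *
        mask (Suc n) (((\<xi> + of_int a) / scale N (Suc n) - of_int l0 / of_int (N (Suc n))) + of_int l / of_int (N (Suc n)))" for a l
    proof -
      have eq: "\<xi> + of_int (f (a, l)) = (\<xi> + of_int a) + scale N n * of_int (l - l0)"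
        by (simp add: f_def of_int_int_scale)
      have "(\<xi> + of_int (f (a, l))) / scale N (Suc n) =
          ((\<xi> + of_int a) / scale N (Suc n) - of_int l0 / of_int (N (Suc n))) + of_int l / of_int (N (Suc n))"
        using scale_pos[of n] by (simp add: eq scale_Suc add_divide_distrib diff_divide_distrib)
      then show ?thesis
        unfolding mask_prod_Suc by (simp only:) (simp only: eq mask_prod_periodic)
    qed
    then have "(\<Sum>i\<in>\<Lambda> \<times> L (Suc n). (cmod (mask_prod (Suc n) (\<xi> + of_int (f i))))\<^sup>2) =
        (\<Sum>a\<in>\<Lambda>. (cmod (mask_prod n (\<xi> + of_int a)))\<^sup>2 * (\<Sum>l\<in>L (Suc n). (cmod (mask (Suc n)
          (((\<xi> + of_int a) / scale N (Suc n) - of_int l0 / of_int (N (Suc n))) + of_int l / of_int (N (Suc n)))))\<^sup>2))"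
      by (simp add: sum.cartesian_product' norm_mult power_mult_distrib sum_distrib_left case_prod_beta)
    then show ?thesis
      using assms by (simp add: mask_sum finite_spectrum_def)
  qed
  then have "finite_spectrum (Suc n) (f ` (\<Lambda> \<times> L (Suc n)))"
    using assms L by (intro finite_spectrum_image) (auto simp: finite_spectrum_def)
  moreover have "\<Lambda> \<subseteq> f ` (\<Lambda> \<times> L (Suc n))"
    using l0 by (force simp: f_def)
  ultimately show ?thesis by blast
qed

lemma finite_spectrum_extend:
  assumes "n \<le> m" "finite_spectrum n \<Lambda>"
  shows "\<exists>\<Lambda>'. \<Lambda> \<subseteq> \<Lambda>' \<and> finite_spectrum m \<Lambda>'"
  using assms(1)
proof (induction m rule: dec_induct)
  case base
  then show ?case using assms(2) by blast
next
  case (step m)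
  then show ?case using finite_spectrum_Suc by (meson order_trans)
qed

lemma finite_spectrum_shift:
  assumes "finite_spectrum n \<Lambda>"
  shows "finite_spectrum n ((\<lambda>a. a + int_scale n * k a) ` \<Lambda>)"
proof (rule finite_spectrum_image)
  fix \<xi>
  have "mask_prod n (\<xi> + of_int (a + int_scale n * k a)) = mask_prod n (\<xi> + of_int a)" for a
    using mask_prod_periodic[of n "\<xi> + of_int a" "k a"] by (simp add: of_int_int_scale add.assoc)
  then show "(\<Sum>a\<in>\<Lambda>. (cmod (mask_prod n (\<xi> + of_int (a + int_scale n * k a))))\<^sup>2) = 1"
    using assms by (simp add: finite_spectrum_def)
qed (use assms in \<open>simp add: finite_spectrum_def\<close>)

text \<open>The margin \<open>\<delta>\<close> allows the frequencies \<open>a\<close> to be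
  replaced by \<open>\<xi> + a\<close> for any fixed \<open>\<xi>\<close>, once
  \<open>\<xi> / scale N n\<close> is smaller than \<open>\<delta>\<close>.\<close>

definition good_spectrum :: "real \<Rightarrow> real \<Rightarrow> nat \<Rightarrow> int set \<Rightarrow> bool" where
  "good_spectrum \<epsilon> \<delta> n \<Lambda> \<longleftrightarrow> finite_spectrum n \<Lambda> \<and>
     (\<forall>a\<in>\<Lambda>. \<forall>y. \<bar>y\<bar> < \<delta> \<longrightarrow> \<epsilon> \<le> cmod (ft (nu_tail N B n) (of_int a / scale N n + y)))"

text \<open>Old elements must stay in place: at a high level \<open>m\<close> they are scaled close
  to 0, where the transform is close to 1. New elements are moved to good integer translates. The
  Lipschitz constant \<open>2 * pi\<close> and the distance \<open>2 * \<delta>\<close> explain the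
  bounds \<open>1 / (8 * pi)\<close> and \<open>1 / 2\<close>.\<close>

lemma good_spectrum_extend:
  assumes "infinite S" "\<delta> > 0" "\<epsilon> \<le> 1 / 2" "\<delta> \<le> 1 / (8 * pi)"
    and equi: "\<And>n x. n \<in> S \<Longrightarrow> \<exists>k::int. \<forall>y. \<bar>y\<bar> < \<delta> \<longrightarrow> \<epsilon> \<le> cmod (ft (nu_tail N B n) (x + of_int k + y))"
    and \<Lambda>: "finite_spectrum n \<Lambda>"
  shows "\<exists>m \<Lambda>'. n < m \<and> \<Lambda> \<subseteq> \<Lambda>' \<and> good_spectrum \<epsilon> \<delta> m \<Lambda>'"
proof -
  have "finite \<Lambda>" using \<Lambda> by (simp add: finite_spectrum_def)
  then have "finite ((\<lambda>a. real_of_int \<bar>a\<bar> / \<delta>) ` \<Lambda>)" by simp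
  then obtain K where K: "\<And>a. a \<in> \<Lambda> \<Longrightarrow> real_of_int \<bar>a\<bar> / \<delta> \<le> K"
    by (meson bdd_above_finite bdd_above.E imageI)
  \<comment> \<open>Since \<open>m \<le> 2 ^ m \<le> scale N m\<close>, a level above
    \<open>K\<close> scales all of \<open>\<Lambda>\<close> into the
    \<open>\<delta>\<close>-neighbourhood of 0.\<close>
  obtain m where m: "m \<in> S" "m > max n (nat \<lceil>K\<rceil>)"
    using \<open>infinite S\<close> unfolding infinite_nat_iff_unbounded by blast
  have small: "\<bar>of_int a / scale N m\<bar> < \<delta>" if "a \<in> \<Lambda>" for a
  proof -
    have "K < real m" using m(2) by linarith
    also have "\<dots> \<le> 2 ^ m"
      by (simp add: less_imp_le of_nat_less_two_power)
    also have "\<dots> \<le> scale N m" by (rule scale_ge)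
    finally have "real_of_int \<bar>a\<bar> / \<delta> < scale N m"
      using K[OF that] by simp
    then show ?thesis
      using \<open>\<delta> > 0\<close> scale_pos[of m] by (simp add: field_simps)
  qed
  obtain \<Lambda>1 where \<Lambda>1: "\<Lambda> \<subseteq> \<Lambda>1" "finite_spectrum m \<Lambda>1"
    using finite_spectrum_extend[OF _ \<Lambda>, of m] m(2) by auto
  obtain k' :: "real \<Rightarrow> int" where k': "\<And>x y. \<bar>y\<bar> < \<delta> \<Longrightarrow> \<epsilon> \<le> cmod (ft (nu_tail N B m) (x + of_int (k' x) + y))"
    using equi[OF m(1)] by metis
  define k where "k a = (if a \<in> \<Lambda> then 0 else k' (of_int a / scale N m))" for a
  let ?\<Lambda>' = "(\<lambda>a. a + int_scale m * k a) ` \<Lambda>1"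
  have "\<Lambda> \<subseteq> ?\<Lambda>'"
  proof
    fix a assume "a \<in> \<Lambda>"
    then show "a \<in> ?\<Lambda>'"
      using \<Lambda>1(1) by (intro image_eqI[of _ _ a]) (auto simp: k_def)
  qed
  moreover have "\<epsilon> \<le> cmod (ft (nu_tail N B m) (of_int (a + int_scale m * k a) / scale N m + y))"
    if y: "\<bar>y\<bar> < \<delta>" and "a \<in> \<Lambda>1" for a y
  proof -
    have eq: "of_int (a + int_scale m * k a) / scale N m = of_int a / scale N m + of_int (k a)"
      using scale_pos[of m] by (simp add: of_int_int_scale add_divide_distrib)
    show ?thesis
    proof (cases "a \<in> \<Lambda>")
      case True
      interpret real_distribution "nu_tail N B m" by (rule real_distribution_nu_tail)
      let ?z = "of_int a / scale N m + y"
      have "cmod (ft (nu_tail N B m) 0 - ft (nu_tail N B m) ?z) \<le> 2 * pi * \<bar>0 - ?z\<bar>"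
        by (rule norm_ft_diff_le[OF real_distribution_nu_tail AE_nu_tail])
      also have "\<dots> \<le> 2 * pi * (\<delta> + \<delta>)"
        using small[OF True] y by (intro mult_left_mono) (linarith, simp)
      also have "\<dots> \<le> 1 / 2"
        using \<open>\<delta> \<le> 1 / (8 * pi)\<close> by (simp add: field_simps)
      finally have "cmod (1 - ft (nu_tail N B m) ?z) \<le> 1 / 2"
        by (simp add: ft_def char_zero)
      then have "1 / 2 \<le> cmod (ft (nu_tail N B m) ?z)"
        using norm_triangle_sub[of 1 "ft (nu_tail N B m) ?z"] by simp
      then show ?thesis
        using \<open>\<epsilon> \<le> 1 / 2\<close> True unfolding eq by (simp add: k_def)
    next
      case False
      then show ?thesis
        using k'[OF y, of "of_int a / scale N m"] unfolding eq by (simp add: k_def)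
    qed
  qed
  ultimately show ?thesis
    using m(2) finite_spectrum_shift[OF \<Lambda>1(2), of k]
    by (intro exI[of _ m] exI[of _ ?\<Lambda>']) (auto simp: good_spectrum_def)
qed

end

section \<open>The spectrum of the limit\<close>

context hadamard_moran
begin

lemma good_spectrum_sequence:
  assumes "infinite S" "\<delta> > 0" "\<epsilon> \<le> 1 / 2" "\<delta> \<le> 1 / (8 * pi)"
    and equi: "\<And>n x. n \<in> S \<Longrightarrow> \<exists>k::int. \<forall>y. \<bar>y\<bar> < \<delta> \<longrightarrow> \<epsilon> \<le> cmod (ft (nu_tail N B n) (x + of_int k + y))"
  obtains p \<Lambda> where "strict_mono p" "incseq \<Lambda>" "\<And>j. good_spectrum \<epsilon> \<delta> (p j) (\<Lambda> j)"
proof -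
  have extend: "\<exists>m \<Lambda>'. n < m \<and> \<Lambda> \<subseteq> \<Lambda>' \<and> good_spectrum \<epsilon> \<delta> m \<Lambda>'" if "finite_spectrum n \<Lambda>" for n \<Lambda>
    using assms that by (rule good_spectrum_extend)
  have "\<exists>F. \<forall>j. good_spectrum \<epsilon> \<delta> (fst (F j)) (snd (F j)) \<and>
      (fst (F j) < fst (F (Suc j)) \<and> snd (F j) \<subseteq> snd (F (Suc j)))"
  proof (rule dependent_nat_choice)
    \<comment> \<open>The trivial spectrum at level 0 need not be good itself; one extension of it
      starts the sequence.\<close>
    show "\<exists>x. good_spectrum \<epsilon> \<delta> (fst x) (snd x)"
      using extend[OF finite_spectrum_0] by auto
    fix x :: "nat \<times> int set"
    assume "good_spectrum \<epsilon> \<delta> (fst x) (snd x)"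
    then show "\<exists>y. good_spectrum \<epsilon> \<delta> (fst y) (snd y) \<and> (fst x < fst y \<and> snd x \<subseteq> snd y)"
      using extend[of "fst x" "snd x"] by (auto simp: good_spectrum_def)
  qed
  then obtain F where F: "\<And>j. good_spectrum \<epsilon> \<delta> (fst (F j)) (snd (F j))"
    "\<And>j. fst (F j) < fst (F (Suc j))" "\<And>j. snd (F j) \<subseteq> snd (F (Suc j))"
    by blast
  show ?thesis
  proof
    show "strict_mono (\<lambda>j. fst (F j))"
      using F(2) by (simp add: strict_mono_Suc_iff)
    show "incseq (\<lambda>j. snd (F j))"
      by (rule incseq_SucI) (rule F(3))
  qed (rule F(1))
qed

text \<open>Orthogonality is inherited from a common finite level, because \<open>mask_prod\<close>
  divides the transform of the limit. For completeness, the Parseval sums \<open>A j\<close> of the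
  limit measure increase to some \<open>Q\<close>, and the uniform lower bound
  \<open>\<epsilon>\<close> on the tails forces \<open>Q\<close> to be at least 1.\<close>

lemma is_spectrum_Union:
  assumes p: "strict_mono p" and \<Lambda>: "incseq \<Lambda>" and good: "\<And>j. good_spectrum \<epsilon> \<delta> (p j) (\<Lambda> j)"
    and "\<epsilon> > 0" "\<delta> > 0"
  shows "is_spectrum (cantor_moran N B) (of_int ` (\<Union>j. \<Lambda> j))"
proof (rule is_spectrumI)
  let ?\<mu> = "cantor_moran N B"
  show distr: "real_distribution ?\<mu>"
    unfolding cantor_moran_eq by (rule real_distribution_mu_tail)
  then interpret real_distribution ?\<mu> .
  show "AE x in ?\<mu>. x \<in> {0..1}"
    using AE_mu_tail[of 0] unfolding cantor_moran_eq by (simp add: scale_def)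
  have fin: "finite (\<Lambda> j)" and sum_1: "(\<Sum>a\<in>\<Lambda> j. (cmod (mask_prod (p j) (\<xi> + of_int a)))\<^sup>2) = 1" for j \<xi>
    using good[of j] by (auto simp: good_spectrum_def finite_spectrum_def)
  show "(of_int ` (\<Union>j. \<Lambda> j) :: real set) \<noteq> {}"
  proof
    assume "(of_int ` (\<Union>j. \<Lambda> j) :: real set) = {}"
    then have "\<Lambda> 0 = {}" by simp
    then show False using sum_1[of 0 0] by simp
  qed
  show "countable (of_int ` (\<Union>j. \<Lambda> j) :: real set)"
    by simp
  show "ft ?\<mu> (a - b) = (if a = b then 1 else 0)"
    if "a \<in> of_int ` (\<Union>j. \<Lambda> j)" "b \<in> of_int ` (\<Union>j. \<Lambda> j)" for a b
  proof -
    from that obtain k l i j where kl: "a = of_int k" "b = of_int l" "k \<in> \<Lambda> i" "l \<in> \<Lambda> j"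
      by auto
    define m where "m = max i j"
    have "k \<in> \<Lambda> m" "l \<in> \<Lambda> m"
      using kl incseqD[OF \<Lambda>, of i m] incseqD[OF \<Lambda>, of j m] by (auto simp: m_def)
    then have "mask_prod (p m) (a - b) = 0" if "a \<noteq> b"
      using eq_if_indexed_sum_1[OF fin sum_1, of k m l] that kl by auto
    then show ?thesis
      using ft_cantor_moran[of "a - b" "p m"] char_zero by (auto simp: ft_def)
  qed
  fix \<xi> e :: real assume "e > 0"
  define a where "a k = (cmod (ft ?\<mu> (\<xi> + of_int k)))\<^sup>2" for k :: int
  define A where "A j = (\<Sum>k\<in>\<Lambda> j. a k)" for j
  have "incseq A"
    unfolding incseq_def A_def using incseqD[OF \<Lambda>] fin by (auto intro!: sum_mono2 simp: a_def)
  have "A j \<le> 1" for j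
  proof -
    have "a k \<le> (cmod (mask_prod (p j) (\<xi> + of_int k)))\<^sup>2" for k
    proof -
      interpret nu: real_distribution "nu_tail N B (p j)" by (rule real_distribution_nu_tail)
      have "cmod (ft (nu_tail N B (p j)) z) \<le> 1" for z
        by (simp add: ft_def nu.cmod_char_le_1)
      then show ?thesis
        unfolding a_def ft_cantor_moran[of _ "p j"] norm_mult by (intro power_mono mult_left_le) auto
    qed
    then have "A j \<le> (\<Sum>k\<in>\<Lambda> j. (cmod (mask_prod (p j) (\<xi> + of_int k)))\<^sup>2)"
      unfolding A_def by (rule sum_mono)
    then show ?thesis by (simp add: sum_1)
  qed
  then obtain Q where Q: "A \<longlonglongrightarrow> Q"
    using incseq_convergent[OF \<open>incseq A\<close>, of 1] by blast
  \<comment> \<open>From some level on, \<open>\<xi> / scale N (p j)\<close> is an admissible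
    displacement \<open>y\<close> in \<open>good_spectrum\<close>.\<close>
  have "eventually (\<lambda>j. \<bar>\<xi>\<bar> / \<delta> < scale N (p j)) sequentially"
    using eventually_gt_at_top[of "nat \<lceil>\<bar>\<xi>\<bar> / \<delta>\<rceil>"]
  proof eventually_elim
    case (elim j)
    then have "\<bar>\<xi>\<bar> / \<delta> < real j" by linarith
    also have "\<dots> \<le> real (p j)"
      using strict_mono_imp_increasing[OF p, of j] by simp
    also have "\<dots> \<le> 2 ^ p j"
      by (simp add: less_imp_le of_nat_less_two_power)
    also have "\<dots> \<le> scale N (p j)" by (rule scale_ge)
    finally show ?case .
  qed
  then have large: "eventually (\<lambda>j. \<bar>\<xi> / scale N (p j)\<bar> < \<delta>) sequentially"
  proof eventually_elim
    case (elim j)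
    then show ?case
      using \<open>\<delta> > 0\<close> scale_pos[of "p j"] by (simp add: field_simps)
  qed
  txt \<open>Beyond \<open>\<Lambda> i\<close> the mass at level \<open>p j\<close> is at most \<open>1 / \<epsilon>\<^sup>2\<close> times the limiting mass.\<close>
  have tail: "1 \<le> A i + (Q - A i) / \<epsilon>\<^sup>2" for i
  proof (rule LIMSEQ_le_const)
    define P where "P j k = (cmod (mask_prod (p j) (\<xi> + of_int k)))\<^sup>2" for j k
    have "(\<lambda>j. mask_prod (p j) (\<xi> + of_int k)) \<longlonglongrightarrow> ft ?\<mu> (\<xi> + of_int k)" for k
      using LIMSEQ_subseq_LIMSEQ[OF mask_prod_tendsto p] by (simp add: comp_def)
    \<comment> \<open>Over the fixed finite set \<open>\<Lambda> i\<close> the limit can be taken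
      term by term.\<close>
    then show "(\<lambda>j. (\<Sum>k\<in>\<Lambda> i. P j k) + (A j - A i) / \<epsilon>\<^sup>2) \<longlonglongrightarrow> A i + (Q - A i) / \<epsilon>\<^sup>2"
      unfolding P_def A_def[of i] a_def using \<open>\<epsilon> > 0\<close> by (intro tendsto_intros Q) auto
    have "eventually (\<lambda>j. 1 \<le> (\<Sum>k\<in>\<Lambda> i. P j k) + (A j - A i) / \<epsilon>\<^sup>2) sequentially"
      using large eventually_ge_at_top[of i]
    proof eventually_elim
      case (elim j)
      have sub: "\<Lambda> i \<subseteq> \<Lambda> j"
        using incseqD[OF \<Lambda> elim(2)] .
      have "P j k \<le> a k / \<epsilon>\<^sup>2" if "k \<in> \<Lambda> j" for k
      proof -
        have "\<epsilon> \<le> cmod (ft (nu_tail N B (p j)) ((\<xi> + of_int k) / scale N (p j)))"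
          using good[of j] elim(1) that by (auto simp: good_spectrum_def add_divide_distrib add.commute)
        then have "\<epsilon>\<^sup>2 \<le> (cmod (ft (nu_tail N B (p j)) ((\<xi> + of_int k) / scale N (p j))))\<^sup>2"
          using \<open>\<epsilon> > 0\<close> by (intro power_mono) auto
        then have "P j k * \<epsilon>\<^sup>2 \<le> a k"
          unfolding P_def a_def ft_cantor_moran[of _ "p j"] norm_mult power_mult_distrib
          by (intro mult_left_mono) auto
        then show ?thesis
          using \<open>\<epsilon> > 0\<close> by (simp add: field_simps)
      qed
      then have "(\<Sum>k\<in>\<Lambda> j - \<Lambda> i. P j k) \<le> (\<Sum>k\<in>\<Lambda> j - \<Lambda> i. a k / \<epsilon>\<^sup>2)"
        by (intro sum_mono) auto
      also have "\<dots> = (A j - A i) / \<epsilon>\<^sup>2"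
        using sub fin by (simp add: A_def sum_diff flip: sum_divide_distrib)
      finally have "(\<Sum>k\<in>\<Lambda> j. P j k) \<le> (\<Sum>k\<in>\<Lambda> i. P j k) + (A j - A i) / \<epsilon>\<^sup>2"
        using sub fin by (simp add: sum_diff)
      then show ?case by (simp add: P_def sum_1)
    qed
    then show "\<exists>n. \<forall>j\<ge>n. 1 \<le> (\<Sum>k\<in>\<Lambda> i. P j k) + (A j - A i) / \<epsilon>\<^sup>2"
      by (simp add: eventually_sequentially)
  qed
  \<comment> \<open>As \<open>i\<close> grows, the error
    \<open>(Q - A i) / \<epsilon>\<^sup>2\<close> in \<open>tail\<close> tends to 0.\<close>
  have "1 \<le> Q"
  proof (rule LIMSEQ_le_const)
    have "(\<lambda>i. A i + (Q - A i) / \<epsilon>\<^sup>2) \<longlonglongrightarrow> Q + (Q - Q) / \<epsilon>\<^sup>2"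
      using \<open>\<epsilon> > 0\<close> by (intro tendsto_intros Q) auto
    then show "(\<lambda>i. A i + (Q - A i) / \<epsilon>\<^sup>2) \<longlonglongrightarrow> Q" by simp
  qed (use tail in blast)
  then have "1 - e < Q" using \<open>e > 0\<close> by simp
  from order_tendstoD(1)[OF Q this] obtain j where "1 - e < A j"
    by (auto dest: eventually_happens)
  then show "\<exists>F. finite F \<and> F \<subseteq> of_int ` (\<Union>j. \<Lambda> j) \<and> 1 - e < (\<Sum>a\<in>F. (cmod (ft ?\<mu> (\<xi> + a)))\<^sup>2)"
    using fin[of j] by (intro exI[of _ "of_int ` \<Lambda> j"]) (auto simp: A_def a_def sum.reindex inj_on_def)
qed

end

theorem theorem1p4:
  fixes N :: "nat \<Rightarrow> int" and B L :: "nat \<Rightarrow> int set"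
  assumes "\<And>n. n \<ge> 1 \<Longrightarrow> hadamard_triple (N n) (B n) (L n)"
    and "\<And>n. n \<ge> 1 \<Longrightarrow> B n \<subseteq> {0..N n - 1}"
    and "\<not> weak_conv_m (nu_tail N B) (unif_dirac {0, 1})"
  shows "spectral_measure (cantor_moran N B) \<and>
         (\<exists>\<Lambda>. is_spectrum (cantor_moran N B) \<Lambda> \<and> \<Lambda> \<subseteq> \<int>)"
proof -
  interpret hadamard_moran N B L
  proof
    show "2 \<le> N n" "B n \<noteq> {}" if "1 \<le> n" for n
      using assms(1)[OF that] by (auto simp: hadamard_triple_def)
  qed (use assms(1,2) in blast)+
  obtain S \<epsilon> \<delta> where S: "infinite S" "\<epsilon> > 0" "\<delta> > 0"
    "\<And>n x. n \<in> S \<Longrightarrow> \<exists>k::int. \<forall>y. \<bar>y\<bar> < \<delta> \<longrightarrow> \<epsilon> \<le> cmod (ft (nu_tail N B n) (x + of_int k + y))"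
    using equi_positive_subsequence[of "nu_tail N B", OF real_distribution_nu_tail AE_nu_tail assms(3)] by blast
  \<comment> \<open>Shrinking both constants preserves the lower bounds and meets the size
    conditions of \<open>good_spectrum_extend\<close>.\<close>
  define \<epsilon>' \<delta>' where "\<epsilon>' = min \<epsilon> (1 / 2)" and "\<delta>' = min \<delta> (1 / (8 * pi))"
  have pos: "\<epsilon>' > 0" "\<delta>' > 0" and le: "\<epsilon>' \<le> 1 / 2" "\<delta>' \<le> 1 / (8 * pi)"
    using S(2,3) by (auto simp: \<epsilon>'_def \<delta>'_def)
  have equi: "\<exists>k::int. \<forall>y. \<bar>y\<bar> < \<delta>' \<longrightarrow> \<epsilon>' \<le> cmod (ft (nu_tail N B n) (x + of_int k + y))" if "n \<in> S" for n x
    using S(4)[OF that, of x] by (auto simp: \<epsilon>'_def \<delta>'_def min_le_iff_disj)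
  obtain p \<Lambda> where "strict_mono p" "incseq \<Lambda>" "\<And>j. good_spectrum \<epsilon>' \<delta>' (p j) (\<Lambda> j)"
    using good_spectrum_sequence[OF S(1) pos(2) le equi] by blast
  then have "is_spectrum (cantor_moran N B) (of_int ` (\<Union>j. \<Lambda> j))"
    using pos by (rule is_spectrum_Union)
  moreover have "(of_int ` (\<Union>j. \<Lambda> j) :: real set) \<subseteq> \<int>"
    by auto
  moreover have "real_distribution (cantor_moran N B)"
    unfolding cantor_moran_eq by (rule real_distribution_mu_tail)
  ultimately show ?thesis
    unfolding spectral_measure_def by blast
qed

end
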